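(* Let $\Phi:\mathrm{Alt}_5^{\oplus4}\to\mathrm{Sym}^2(\mathbb{C}^4)$, $\Phi(X)=(\varphi_{st}(X))_{1\le s,t\le4}$, be the explicit polynomial map defined in the context, where $\mathrm{Alt}_5$ is the space of skew-symmetric complex $5\times 5$ matrices and $\mathrm{Sym}^2(\mathbb{C}^4)$ is the space of symmetric complex $4\times4$ matrices. Then: (i) The map $\Phi:\mathrm{Alt}_5^{\oplus4}\to\mathrm{Sym}^2(\mathbb{C}^4)$ is surjective. (ii) $f(X)=\det\Phi(X)$ is the irreducible relative invariant (unique up to a nonzero constant multiple) of the prehomogeneous vector space $(SL_5\times GL_4,\rho,\mathrm{Alt}_5^{\oplus4})$; that is, $f$ is an irreducible polynomial, it is homogeneous of degree $40$, and it corresponds to the rational character $(\det B)^{10}$: $f(\rho(A,B)X)=(\det B)^{10}f(X)$ for all $(A,B)\in SL_5(\mathbb{C})\times GL_4(\mathbb{C})$ and $X\in\mathrm{Alt}_5^{\oplus 4}$.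
   Context: Representation: $\rho(A,B)(X_1,X_2,X_3,X_4)=(AX_1{}^tA,AX_2{}^tA,AX_3{}^tA,AX_4{}^tA)\,{}^tB$, i.e. the $k$-th component of $\rho(A,B)(X_1,\dots,X_4)$ is $\sum_j B_{kj}AX_j{}^tA$. A relative invariant is a nonzero polynomial $f$ with $f(\rho(g)X)=\chi(g)f(X)$ for some rational character $\chi$ of the group. The form $\beta$: for $Z=(z_{ij})\in\mathrm{Alt}_4$ (skew-symmetric $4\times4$ matrices) let $\mathrm{Pf}(Z)=z_{12}z_{34}-z_{13}z_{24}+z_{14}z_{23}$. For $X\in\mathrm{Alt}_5$ let $X^{(i)}\in\mathrm{Alt}_4$ be $X$ with $i$-th row and column deleted. $\beta(X,Y)\in\mathbb{C}^5$ is the column vector whose $i$-th entry is $(-1)^{i-1}\big(\mathrm{Pf}(X^{(i)}+Y^{(i)})-\mathrm{Pf}(X^{(i)})-\mathrm{Pf}(Y^{(i)})\big)$. For $i,j,k,l,m\in\{1,2,3,4\}$, $[ijklm]$ is the polynomial on $\mathrm{Alt}_5^{\oplus4}$ given by $[ijklm](X_1,X_2,X_3,X_4)={}^t\beta(X_i,X_j)\,X_k\,\beta(X_l,X_m)$. Define $$\begin{aligned}\varphi_{11}=\;&160[31114](3[24132]-2[21342]-2[23412])\\&+160[41112](3[32143]-2[34213]-2[31423])\\&+160[21113](3[43124]-2[41234]-2[42314])\\&+50([11233][11244]+[11322][11344]+[11422][11433])\\&-288([13241]^2+[14321]^2+[12431]^2)\\&+224([13241][14321]+[14321][12431]+[12431][13241]),\end{aligned}$$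 $$\begin{aligned}\varphi_{12}=\;&400[31114][32224]-100([21113][22344]+[21114][22433])\\&-100([12223][11344]+[12224][11433])\\&+20[11422](4[31423]-[34213]-[32143])\\&+20[11322](4[41324]-[43214]-[42134])\\&-25([22144][11233]+[11244][22133])+368[13241][23142]\\&+112([13241]([21342]+[23412])+[23142]([12341]+[13421]))\\&+192([14321][23412]+[13421][24312])\\&-208([14321][21342]+[12431][23412]).\end{aligned}$$ For $\sigma\in\mathfrak{S}_4$ and a polynomial $P$ in the $[ijklm]$, $P^\sigma$ is obtained by replacing each $[ijklm]$ by $[\sigma^{-1}(i)\sigma^{-1}(j)\sigma^{-1}(k)\sigma^{-1}(l)\sigma^{-1}(m)]$ (equivalently $P^\sigma(X)=P(X\,{}^t\sigma)$ with $\sigma$ regarded as the permutation matrix whose $(i,j)$ entry is $1$ iff $i=\sigma(j)$). Put $\varphi_{ss}=\varphi_{11}^{(1\ s)}$ for $s=1,\dots,4$, and for $s\ne t$ put $\varphi_{st}=\varphi_{12}^{\sigma}$ for any $\sigma\in\mathfrak{S}_4$ with $\sigma^{-1}(1)=s$, $\sigma^{-1}(2)=t$ (this does not depend on the choice of $\sigma$, and $\varphi_{st}=\varphi_{ts}$). *)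

theory Defs
  imports
    "HOL-Analysis.Analysis"
    "HOL-Library.Poly_Mapping"
    "HOL-Computational_Algebra.Factorial_Ring"
begin

section \<open>The representation\<close>

text \<open>
  The finite index types \<open>4\<close> and \<open>5\<close> carry the labels \<open>1,\<dots>,4\<close> and \<open>1,\<dots>,5\<close>, as in the library
  function \<^const>\<open>vector\<close>. In these types \<open>4 = 0\<close> and \<open>5 = 0\<close> respectively, so the type order is
  not the order of the labels; wherever the order of the labels matters the labels are listed explicitly.
\<close>

definition Alt5 :: "(complex^5^5) set" where
  "Alt5 = {X. transpose X = - X}"

definition V :: "(complex^5^5^4) set" where
  "V = {X. \<forall>k. X $ k \<in> Alt5}"

definition Sym4 :: "(complex^4^4) set" where
  "Sym4 = {S. transpose S = S}"

definition G :: "((complex^5^5) \<times> (complex^4^4)) set" where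
  "G = {(A, B). det A = 1 \<and> invertible B}"

definition rho :: "(complex^5^5) \<times> (complex^4^4) \<Rightarrow> complex^5^5^4 \<Rightarrow> complex^5^5^4" where
  "rho = (\<lambda>(A, B) X. \<chi> k. \<Sum>j\<in>UNIV. map_matrix (\<lambda>z. B $ k $ j * z) (A ** X $ j ** transpose A))"


section \<open>The map Phi\<close>

definition Pf :: "complex^4^4 \<Rightarrow> complex" where
  "Pf Z = Z $ 1 $ 2 * Z $ 3 $ 4 - Z $ 1 $ 3 * Z $ 2 $ 4 + Z $ 1 $ 4 * Z $ 2 $ 3"

definition del :: "5 \<Rightarrow> complex^5^5 \<Rightarrow> complex^4^4" where
  "del i X = (let r = filter (\<lambda>p. p \<noteq> i) [1, 2, 3, 4, 5]
              in vector (map (\<lambda>p. vector (map (\<lambda>q. X $ p $ q) r)) r))"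

definition beta :: "complex^5^5 \<Rightarrow> complex^5^5 \<Rightarrow> complex^5" where
  "beta X Y = (let d = (\<lambda>i. Pf (del i X + del i Y) - Pf (del i X) - Pf (del i Y))
               in vector [d 1, - d 2, d 3, - d 4, d 5])"

definition bracket :: "complex^5^5^4 \<Rightarrow> 4 \<Rightarrow> 4 \<Rightarrow> 4 \<Rightarrow> 4 \<Rightarrow> 4 \<Rightarrow> complex" where
  "bracket X i j k l m =
     scalar_product (beta (X $ i) (X $ j)) (X $ k *v beta (X $ l) (X $ m))"

text \<open>
  Polynomials in the brackets are written as functions of the family \<open>b\<close> of brackets, so that
  \<open>P\<^sup>\<sigma>\<close> is obtained by precomposition with \<open>perm_bracket \<sigma>\<close>.
\<close>

definition phi11 :: "(4 \<Rightarrow> 4 \<Rightarrow> 4 \<Rightarrow> 4 \<Rightarrow> 4 \<Rightarrow> complex) \<Rightarrow> complex" where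
  "phi11 b =
    160 * b 3 1 1 1 4 * (3 * b 2 4 1 3 2 - 2 * b 2 1 3 4 2 - 2 * b 2 3 4 1 2)
    + 160 * b 4 1 1 1 2 * (3 * b 3 2 1 4 3 - 2 * b 3 4 2 1 3 - 2 * b 3 1 4 2 3)
    + 160 * b 2 1 1 1 3 * (3 * b 4 3 1 2 4 - 2 * b 4 1 2 3 4 - 2 * b 4 2 3 1 4)
    + 50 * (b 1 1 2 3 3 * b 1 1 2 4 4 + b 1 1 3 2 2 * b 1 1 3 4 4 + b 1 1 4 2 2 * b 1 1 4 3 3)
    - 288 * ((b 1 3 2 4 1)^2 + (b 1 4 3 2 1)^2 + (b 1 2 4 3 1)^2)
    + 224 * (b 1 3 2 4 1 * b 1 4 3 2 1 + b 1 4 3 2 1 * b 1 2 4 3 1 + b 1 2 4 3 1 * b 1 3 2 4 1)"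

definition phi12 :: "(4 \<Rightarrow> 4 \<Rightarrow> 4 \<Rightarrow> 4 \<Rightarrow> 4 \<Rightarrow> complex) \<Rightarrow> complex" where
  "phi12 b =
    400 * b 3 1 1 1 4 * b 3 2 2 2 4
    - 100 * (b 2 1 1 1 3 * b 2 2 3 4 4 + b 2 1 1 1 4 * b 2 2 4 3 3)
    - 100 * (b 1 2 2 2 3 * b 1 1 3 4 4 + b 1 2 2 2 4 * b 1 1 4 3 3)
    + 20 * b 1 1 4 2 2 * (4 * b 3 1 4 2 3 - b 3 4 2 1 3 - b 3 2 1 4 3)
    + 20 * b 1 1 3 2 2 * (4 * b 4 1 3 2 4 - b 4 3 2 1 4 - b 4 2 1 3 4)
    - 25 * (b 2 2 1 4 4 * b 1 1 2 3 3 + b 1 1 2 4 4 * b 2 2 1 3 3)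
    + 368 * b 1 3 2 4 1 * b 2 3 1 4 2
    + 112 * (b 1 3 2 4 1 * (b 2 1 3 4 2 + b 2 3 4 1 2) + b 2 3 1 4 2 * (b 1 2 3 4 1 + b 1 3 4 2 1))
    + 192 * (b 1 4 3 2 1 * b 2 3 4 1 2 + b 1 3 4 2 1 * b 2 4 3 1 2)
    - 208 * (b 1 4 3 2 1 * b 2 1 3 4 2 + b 1 2 4 3 1 * b 2 3 4 1 2)"

definition perm_bracket ::
  "(4 \<Rightarrow> 4) \<Rightarrow> (4 \<Rightarrow> 4 \<Rightarrow> 4 \<Rightarrow> 4 \<Rightarrow> 4 \<Rightarrow> complex) \<Rightarrow> 4 \<Rightarrow> 4 \<Rightarrow> 4 \<Rightarrow> 4 \<Rightarrow> 4 \<Rightarrow> complex" where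
  "perm_bracket \<sigma> b = (\<lambda>i j k l m. b (inv \<sigma> i) (inv \<sigma> j) (inv \<sigma> k) (inv \<sigma> l) (inv \<sigma> m))"

text \<open>Off the diagonal any \<open>\<sigma>\<close> with the two prescribed values may be taken; the result is the same.\<close>

definition Phi :: "complex^5^5^4 \<Rightarrow> complex^4^4" where
  "Phi X = (\<chi> s t.
     if s = t then phi11 (perm_bracket (Transposition.transpose 1 s) (bracket X))
     else phi12 (perm_bracket (SOME \<sigma>. bij \<sigma> \<and> inv \<sigma> 1 = s \<and> inv \<sigma> 2 = t) (bracket X)))"


section \<open>Polynomials\<close>

text \<open>
  \<open>'v mpoly\<close> is the polynomial ring over the complex numbers in the indeterminates \<open>'v\<close>: a monomial
  is a finitely supported map from indeterminates to exponents.
\<close>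

type_synonym 'v mpoly = "('v \<Rightarrow>\<^sub>0 nat) \<Rightarrow>\<^sub>0 complex"

definition const_mpoly :: "complex \<Rightarrow> 'v mpoly" where
  "const_mpoly c = Poly_Mapping.single 0 c"

definition eval_mpoly :: "('v \<Rightarrow> complex) \<Rightarrow> 'v mpoly \<Rightarrow> complex" where
  "eval_mpoly x p = (\<Sum>m\<in>Poly_Mapping.keys p.
     Poly_Mapping.lookup p m * (\<Prod>v\<in>Poly_Mapping.keys m. x v ^ Poly_Mapping.lookup m v))"

definition homogeneous :: "nat \<Rightarrow> 'v mpoly \<Rightarrow> bool" where
  "homogeneous d p \<longleftrightarrow>
     (\<forall>m\<in>Poly_Mapping.keys p. (\<Sum>v\<in>Poly_Mapping.keys m. Poly_Mapping.lookup m v) = d)"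

text \<open>The 40 coordinates on \<open>V\<close>: the entries above the diagonal of the four matrices.\<close>

typedef coord = "{(k::4, i::5, j::5). (i, j) \<in>
    {(1, 2), (1, 3), (1, 4), (1, 5), (2, 3), (2, 4), (2, 5), (3, 4), (3, 5), (4, 5)}}"
  by (rule exI[of _ "(1, 1, 2)"]) simp

definition coords :: "complex^5^5^4 \<Rightarrow> coord \<Rightarrow> complex" where
  "coords X v = (case Rep_coord v of (k, i, j) \<Rightarrow> X $ k $ i $ j)"

definition poly_at :: "coord mpoly \<Rightarrow> complex^5^5^4 \<Rightarrow> complex" where
  "poly_at f X = eval_mpoly (coords X) f"


section \<open>Prehomogeneity and relative invariants\<close>

definition zariski_dense :: "(complex^5^5^4) set \<Rightarrow> bool" where
  "zariski_dense S \<longleftrightarrow> (\<forall>P. (\<forall>X\<in>S. poly_at P X = 0) \<longrightarrow> P = 0)"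

definition prehomogeneous :: bool where
  "prehomogeneous \<longleftrightarrow> (\<exists>X\<in>V. zariski_dense ((\<lambda>g. rho g X) ` G))"

definition entries :: "(complex^5^5) \<times> (complex^4^4) \<Rightarrow> (5 \<times> 5) + (4 \<times> 4) \<Rightarrow> complex" where
  "entries = (\<lambda>(A, B). case_sum (\<lambda>(i, j). A $ i $ j) (\<lambda>(i, j). B $ i $ j))"

text \<open>
  The regular functions on \<open>G\<close> are the polynomials in the entries of \<open>A\<close> and \<open>B\<close> divided by powers
  of \<open>det B\<close>.
\<close>

definition regular_on_G :: "((complex^5^5) \<times> (complex^4^4) \<Rightarrow> complex) \<Rightarrow> bool" where
  "regular_on_G \<psi> \<longleftrightarrow>
     (\<exists>P n. \<forall>g\<in>G. \<psi> g = eval_mpoly (entries g) P / det (snd g) ^ n)"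

definition rational_character :: "((complex^5^5) \<times> (complex^4^4) \<Rightarrow> complex) \<Rightarrow> bool" where
  "rational_character \<psi> \<longleftrightarrow> regular_on_G \<psi> \<and> (\<forall>g\<in>G. \<psi> g \<noteq> 0) \<and>
     (\<forall>(A, B)\<in>G. \<forall>(A', B')\<in>G. \<psi> (A ** A', B ** B') = \<psi> (A, B) * \<psi> (A', B'))"

definition relative_invariant ::
  "coord mpoly \<Rightarrow> ((complex^5^5) \<times> (complex^4^4) \<Rightarrow> complex) \<Rightarrow> bool" where
  "relative_invariant f \<psi> \<longleftrightarrow> f \<noteq> 0 \<and> rational_character \<psi> \<and>
     (\<forall>g\<in>G. \<forall>X\<in>V. poly_at f (rho g X) = \<psi> g * poly_at f X)"

end

theory Submission
  imports Defs "HOL-Computational_Algebra.Fundamental_Theorem_Algebra"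
begin

text \<open>
  Everything rests on one observation. Alternate the bracket \<open>[dpqre]\<close> over \<open>p,q,r\<close>: with the fourth
  index \<open>a\<close> complementary to \<open>p,q,r\<close> this gives numbers \<open>T\<^sup>a\<^sub>d\<^sub>e(X)\<close> that are symmetric in \<open>d,e\<close>, satisfy
  \<open>\<Sum>\<^sub>a T\<^sup>a\<^sub>a\<^sub>e = 0\<close>, and determine all brackets linearly. Read as structure constants they make four-space a
  commutative algebra; let \<open>L\<^sub>d\<close> be the matrix of multiplication by the \<open>d\<close>-th basis vector. Then
  \<open>\<phi>\<^sub>s\<^sub>t = -4 tr(L\<^sub>s L\<^sub>t)\<close>, so that \<open>\<Phi>\<close> is, up to the factor \<open>-4\<close>, the trace form of this algebra. Symmetry
  of \<open>\<Phi>\<close> and its independence of the permutation chosen off the diagonal are then clear, and the two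
  long polynomials need to be expanded only once each.

  The matrices \<open>L\<^sub>d\<close> transform under \<open>B\<close> in \<open>GL\<^sub>4\<close> like structure constants, twisted by \<open>det B\<close>, and the brackets
  are invariant under \<open>SL\<^sub>5\<close>. Hence \<open>\<Phi>(\<rho>(A,B)X) = (det B)\<^sup>2 B \<Phi>(X) B\<^sup>t\<close> and \<open>f = det \<Phi>\<close> has the character
  \<open>(det B)^10\<close>. Complex symmetric matrices are classified by their rank up to congruence, and a sparse
  family of points \<open>sample p t\<close>, with \<open>f\<close> equal to a nonzero constant times \<open>p\<^sup>2t\<close>, together with \<open>0\<close> realises every
  rank; the scalar \<open>(det B)\<^sup>2\<close> is absorbed by taking a tenth root. This gives surjectivity.

  At \<open>X\<^sub>0\<close>, the member with \<open>p = t = 1\<close>, the differential of the orbit map has an explicit right inverse, so the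
  orbit contains a neighbourhood of \<open>X\<^sub>0\<close>, and a polynomial vanishing on the orbit is zero.

  Irreducibility and uniqueness come from the same argument. Let \<open>p\<close> be a
  polynomial without zeros on the orbit of \<open>X\<^sub>0\<close>; factors of \<open>f\<close> and irreducible relative invariants are of this
  kind. Along the orbit map \<open>p\<close> becomes a polynomial without zeros on a product of general linear
  groups. Such a function is constant along transvections, since a complex polynomial in one variable
  without zeros is constant, and therefore is a constant times a power of the determinant. So
  \<open>p(gX\<^sub>0) = p(X\<^sub>0) (det B)\<^sup>k\<close>, and by density \<open>p^10\<close> is a constant times \<open>f\<^sup>k\<close>. On the curve \<open>t \<mapsto> sample 1 t\<close> the
  invariant \<open>f\<close> has degree one, hence \<open>10\<close> divides \<open>k\<close> and \<open>p\<close> is a constant times a power of \<open>f\<close>.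
\<close>

section \<open>The index types and determinants of size four\<close>

lemma exhaust_5:
  fixes x :: 5
  shows "x = 1 \<or> x = 2 \<or> x = 3 \<or> x = 4 \<or> x = 5"
proof (induct x)
  case (of_int z)
  then have "0 \<le> z" and "z < 5" by simp_all
  then have "z = 0 \<or> z = 1 \<or> z = 2 \<or> z = 3 \<or> z = 4" by arith
  then show ?case by auto
qed

lemma forall_5: "(\<forall>i::5. P i) \<longleftrightarrow> P 1 \<and> P 2 \<and> P 3 \<and> P 4 \<and> P 5"
  by (metis exhaust_5)

lemma UNIV_5: "(UNIV :: 5 set) = {1, 2, 3, 4, 5}"
  using exhaust_5 by auto

lemma sum_5: "sum f (UNIV :: 5 set) = f 1 + f 2 + f 3 + f 4 + f 5"
  unfolding UNIV_5 by (simp add: ac_simps)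

lemma vector_4:
  "(vector [a, b, c, d] :: 'a::zero^4) $ 1 = a"
  "(vector [a, b, c, d] :: 'a::zero^4) $ 2 = b"
  "(vector [a, b, c, d] :: 'a::zero^4) $ 3 = c"
  "(vector [a, b, c, d] :: 'a::zero^4) $ 4 = d"
  unfolding vector_def by simp_all

lemma vector_5:
  "(vector [a, b, c, d, e] :: 'a::zero^5) $ 1 = a"
  "(vector [a, b, c, d, e] :: 'a::zero^5) $ 2 = b"
  "(vector [a, b, c, d, e] :: 'a::zero^5) $ 3 = c"
  "(vector [a, b, c, d, e] :: 'a::zero^5) $ 4 = d"
  "(vector [a, b, c, d, e] :: 'a::zero^5) $ 5 = e"
  unfolding vector_def by simp_all

lemma det_4:
  fixes A :: "'a::comm_ring_1^4^4"
  shows "det A =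
      A$1$1 * A$2$2 * A$3$3 * A$4$4 - A$1$1 * A$2$2 * A$3$4 * A$4$3
    - A$1$1 * A$2$3 * A$3$2 * A$4$4 + A$1$1 * A$2$3 * A$3$4 * A$4$2
    + A$1$1 * A$2$4 * A$3$2 * A$4$3 - A$1$1 * A$2$4 * A$3$3 * A$4$2
    - A$1$2 * A$2$1 * A$3$3 * A$4$4 + A$1$2 * A$2$1 * A$3$4 * A$4$3
    + A$1$2 * A$2$3 * A$3$1 * A$4$4 - A$1$2 * A$2$3 * A$3$4 * A$4$1
    - A$1$2 * A$2$4 * A$3$1 * A$4$3 + A$1$2 * A$2$4 * A$3$3 * A$4$1
    + A$1$3 * A$2$1 * A$3$2 * A$4$4 - A$1$3 * A$2$1 * A$3$4 * A$4$2
    - A$1$3 * A$2$2 * A$3$1 * A$4$4 + A$1$3 * A$2$2 * A$3$4 * A$4$1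
    + A$1$3 * A$2$4 * A$3$1 * A$4$2 - A$1$3 * A$2$4 * A$3$2 * A$4$1
    - A$1$4 * A$2$1 * A$3$2 * A$4$3 + A$1$4 * A$2$1 * A$3$3 * A$4$2
    + A$1$4 * A$2$2 * A$3$1 * A$4$3 - A$1$4 * A$2$2 * A$3$3 * A$4$1
    - A$1$4 * A$2$3 * A$3$1 * A$4$2 + A$1$4 * A$2$3 * A$3$2 * A$4$1"
proof -
  have 1: "finite {2::4, 3, 4}" "1 \<notin> {2::4, 3, 4}" by auto
  have 2: "finite {3::4, 4}" "2 \<notin> {3::4, 4}" by auto
  have 3: "finite {4::4}" "3 \<notin> {4::4}" by auto
  show ?thesis
    unfolding det_def UNIV_4
    unfolding sum_over_permutations_insert[OF 1]
    unfolding sum_over_permutations_insert[OF 2]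
    unfolding sum_over_permutations_insert[OF 3]
    unfolding permutes_sing
    by (simp add: sign_swap_id permutation_swap_id permutation_compose sign_compose sign_id swap_id_eq
        algebra_simps)
qed

lemma beta_nth:
  "beta X Y $ 1 = X$2$3 * Y$4$5 + X$4$5 * Y$2$3 - X$2$4 * Y$3$5 - X$3$5 * Y$2$4 + X$2$5 * Y$3$4 + X$3$4 * Y$2$5"
  "beta X Y $ 2 = - (X$1$3 * Y$4$5 + X$4$5 * Y$1$3 - X$1$4 * Y$3$5 - X$3$5 * Y$1$4 + X$1$5 * Y$3$4 + X$3$4 * Y$1$5)"
  "beta X Y $ 3 = X$1$2 * Y$4$5 + X$4$5 * Y$1$2 - X$1$4 * Y$2$5 - X$2$5 * Y$1$4 + X$1$5 * Y$2$4 + X$2$4 * Y$1$5"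
  "beta X Y $ 4 = - (X$1$2 * Y$3$5 + X$3$5 * Y$1$2 - X$1$3 * Y$2$5 - X$2$5 * Y$1$3 + X$1$5 * Y$2$3 + X$2$3 * Y$1$5)"
  "beta X Y $ 5 = X$1$2 * Y$3$4 + X$3$4 * Y$1$2 - X$1$3 * Y$2$4 - X$2$4 * Y$1$3 + X$1$4 * Y$2$3 + X$2$3 * Y$1$4"
  by (simp_all add: beta_def Let_def vector_5 vector_4 Pf_def del_def algebra_simps)

section \<open>Relations between the brackets\<close>

lemma Alt5_nth:
  assumes "X \<in> Alt5"
  shows "X $ j $ i = - X $ i $ j" "X $ i $ i = 0"
proof -
  have *: "X $ j $ i = - X $ i $ j" for i j
    using assms unfolding Alt5_def mem_Collect_eq vec_eq_iff transpose_def vec_lambda_beta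
      uminus_vec_def by blast
  show "X $ j $ i = - X $ i $ j" by (rule *)
  show "X $ i $ i = 0" using *[of i i] by (metis add.inverse_unique eq_neg_iff_add_eq_0 mult_2 mult_eq_0_iff zero_neq_numeral)
qed

lemma Alt5_lower:
  assumes "X \<in> Alt5"
  shows "X$2$1 = - X$1$2" "X$3$1 = - X$1$3" "X$4$1 = - X$1$4" "X$5$1 = - X$1$5"
    "X$3$2 = - X$2$3" "X$4$2 = - X$2$4" "X$5$2 = - X$2$5"
    "X$4$3 = - X$3$4" "X$5$3 = - X$3$5" "X$5$4 = - X$4$5"
    "X$1$1 = 0" "X$2$2 = 0" "X$3$3 = 0" "X$4$4 = 0" "X$5$5 = 0"
  using Alt5_nth[OF assms] by blast+

lemma beta_commute: "beta X Y = beta Y X"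
  by (simp add: vec_eq_iff forall_5 beta_nth algebra_simps)

lemma beta_add_left: "beta (X + X') Y = beta X Y + beta X' Y"
  by (simp add: vec_eq_iff forall_5 beta_nth algebra_simps)

lemma beta_scale_left: "beta (map_matrix ((*) c) X) Y = c *s beta X Y"
  by (simp add: vec_eq_iff forall_5 beta_nth map_matrix_def algebra_simps)

text \<open>
  This polarises \<open>X \<beta>(X,X) = 0\<close>: the vector \<open>\<beta>(X,X)\<close> is twice the vector of signed subpfaffians of \<open>X\<close>, which spans
  the kernel of a generic skew-symmetric matrix of size five.
\<close>

lemma beta_cyclic:
  assumes "P \<in> Alt5" "Q \<in> Alt5" "R \<in> Alt5"
  shows "P *v beta Q R + Q *v beta P R + R *v beta P Q = 0"
  by (simp add: vec_eq_iff forall_5 beta_nth matrix_vector_mult_def sum_5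
      Alt5_lower[OF assms(1)] Alt5_lower[OF assms(2)] Alt5_lower[OF assms(3)] algebra_simps)

text \<open>
  The bracket with arbitrary matrices in its five slots; in this form it is multilinear.
\<close>

definition five_form :: "complex^5^5 \<Rightarrow> complex^5^5 \<Rightarrow> complex^5^5 \<Rightarrow> complex^5^5 \<Rightarrow> complex^5^5 \<Rightarrow> complex" where
  "five_form D P Q R E = scalar_product (beta D P) (Q *v beta R E)"

lemma bracket_eq_five_form: "bracket X i j k l m = five_form (X$i) (X$j) (X$k) (X$l) (X$m)"
  by (simp add: bracket_def five_form_def)

lemma five_form_commute1: "five_form D P Q R E = five_form P D Q R E"
  and five_form_commute2: "five_form D P Q R E = five_form D P Q E R"
  by (simp_all add: five_form_def beta_commute[of D P] beta_commute[of R E])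

lemma five_form_flip:
  assumes "Q \<in> Alt5"
  shows "five_form D P Q R E = - five_form R E Q D P"
  by (simp add: five_form_def scalar_product_def matrix_vector_mult_def sum_5
      Alt5_lower[OF assms] algebra_simps)

lemma scalar_product_add_right: "scalar_product u (v + w) = scalar_product u v + scalar_product u w"
  for u :: "complex^'n"
  by (simp add: scalar_product_def algebra_simps sum.distrib)

lemma five_form_cyclic:
  assumes "P \<in> Alt5" "Q \<in> Alt5" "R \<in> Alt5"
  shows "five_form L M P Q R + five_form L M Q P R + five_form L M R P Q = 0"
proof -
  have "five_form L M P Q R + five_form L M Q P R + five_form L M R P Q =
      scalar_product (beta L M) (P *v beta Q R + Q *v beta P R + R *v beta P Q)"
    by (simp add: five_form_def scalar_product_add_right)
  then show ?thesis
    by (simp add: beta_cyclic[OF assms] scalar_product_def)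
qed

text \<open>
  The alternation over the three inner slots, which carries the structure constants.
\<close>

definition alt_form :: "complex^5^5 \<Rightarrow> complex^5^5 \<Rightarrow> complex^5^5 \<Rightarrow> complex^5^5 \<Rightarrow> complex^5^5 \<Rightarrow> complex" where
  "alt_form D E P Q R = five_form D P Q R E - five_form D P R Q E + five_form D Q R P E - five_form D Q P R E + five_form D R P Q E - five_form D R Q P E"

lemma alt_form_swap: "alt_form D E Q P R = - alt_form D E P Q R" "alt_form D E P R Q = - alt_form D E P Q R"
  by (simp_all add: alt_form_def)

lemma alt_form_same: "alt_form D E P P R = 0" "alt_form D E P Q P = 0" "alt_form D E P Q Q = 0"
  by (simp_all add: alt_form_def)

lemma five_form_reverse:
  assumes "Q \<in> Alt5"
  shows "five_form E P Q R D = - five_form D R Q P E"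
  using five_form_flip[OF assms, of E P R D] five_form_commute1[of R D Q E P] five_form_commute2[of D R Q E P] by simp

lemma alt_form_commute:
  assumes "P \<in> Alt5" "Q \<in> Alt5" "R \<in> Alt5"
  shows "alt_form E D P Q R = alt_form D E P Q R"
  unfolding alt_form_def
    five_form_reverse[OF assms(1), of E _ _ D] five_form_reverse[OF assms(2), of E _ _ D] five_form_reverse[OF assms(3), of E _ _ D]
  by (simp add: algebra_simps)

text \<open>
  Alternating over all four of \<open>A,B,C,D\<close> makes the symmetric form \<open>\<beta>\<close> of two of them cancel. This is the
  vanishing of the traces of the multiplication matrices.
\<close>

lemma alt_form_trace: "alt_form A E B C D - alt_form B E A C D + alt_form C E A B D - alt_form D E A B C = 0"
  by (simp add: alt_form_def five_form_commute1[of B A] five_form_commute1[of C A] five_form_commute1[of D A]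
     five_form_commute1[of C B] five_form_commute1[of D B] five_form_commute1[of D C])

text \<open>
  In five letters there are fifteen brackets up to symmetry and sign, and the cyclic relations have rank nine.
  The remaining six dimensions are accounted for by the alternated forms, so each bracket must be a
  combination of them.
\<close>

lemma five_form_eq_alt_form:
  assumes "I \<in> Alt5" "J \<in> Alt5" "K \<in> Alt5" "L \<in> Alt5" "M \<in> Alt5"
  shows "10 * five_form I J K L M = alt_form J M I K L + alt_form I M J K L + alt_form J L I K M + alt_form I L J K M"
proof -
  note ord = five_form_commute1[of J I] five_form_commute1[of K I] five_form_commute1[of L I] five_form_commute1[of M I]
    five_form_commute1[of K J] five_form_commute1[of L J] five_form_commute1[of M J]
    five_form_commute1[of L K] five_form_commute1[of M K] five_form_commute1[of M L]
    five_form_commute2[of _ _ _ J I] five_form_commute2[of _ _ _ K I] five_form_commute2[of _ _ _ L I] five_form_commute2[of _ _ _ M I]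
    five_form_commute2[of _ _ _ K J] five_form_commute2[of _ _ _ L J] five_form_commute2[of _ _ _ M J]
    five_form_commute2[of _ _ _ L K] five_form_commute2[of _ _ _ M K] five_form_commute2[of _ _ _ M L]
  note flip =
    five_form_flip[OF assms(5), of J L I K] five_form_flip[OF assms(5), of J K I L] five_form_flip[OF assms(5), of K L I J]
    five_form_flip[OF assms(4), of J M I K] five_form_flip[OF assms(4), of J K I M] five_form_flip[OF assms(4), of K M I J]
    five_form_flip[OF assms(3), of J L I M] five_form_flip[OF assms(3), of J M I L] five_form_flip[OF assms(3), of L M I J]
    five_form_flip[OF assms(2), of K L I M] five_form_flip[OF assms(2), of L M I K] five_form_flip[OF assms(2), of K M I L]
    five_form_flip[OF assms(1), of K L J M] five_form_flip[OF assms(1), of L M J K] five_form_flip[OF assms(1), of K M J L]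
  \<comment> \<open>The coefficients solve the linear system that expresses the difference in the cyclic relations.\<close>
  have "10 * five_form I J K L M - (alt_form J M I K L + alt_form I M J K L + alt_form J L I K M + alt_form I L J K M) =
     - 6 * (five_form L M I J K + five_form L M J I K + five_form L M K I J)
      - 2 * (five_form K M I J L + five_form K M J I L + five_form K M L I J)
      - 2 * (five_form K L I J M + five_form K L J I M + five_form K L M I J)
      - 3 * (five_form J M I K L + five_form J M K I L + five_form J M L I K)
      - 3 * (five_form J L I K M + five_form J L K I M + five_form J L M I K)
      - 4 * (five_form J K I L M + five_form J K L I M + five_form J K M I L)
      - 3 * (five_form I M J K L + five_form I M K J L + five_form I M L J K)
      - 3 * (five_form I L J K M + five_form I L K J M + five_form I L M J K)
      - 4 * (five_form I K J L M + five_form I K L J M + five_form I K M J L)"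
    unfolding alt_form_def ord flip by (simp only: algebra_simps) simp
  also have "\<dots> = 0"
    unfolding
    five_form_cyclic[OF assms(1) assms(2) assms(3), of L M]
    five_form_cyclic[OF assms(1) assms(2) assms(4), of K M]
    five_form_cyclic[OF assms(1) assms(2) assms(5), of K L]
    five_form_cyclic[OF assms(1) assms(3) assms(4), of J M]
    five_form_cyclic[OF assms(1) assms(3) assms(5), of J L]
    five_form_cyclic[OF assms(1) assms(4) assms(5), of J K]
    five_form_cyclic[OF assms(2) assms(3) assms(4), of I M]
    five_form_cyclic[OF assms(2) assms(3) assms(5), of I L]
    five_form_cyclic[OF assms(2) assms(4) assms(5), of I K]
    by simp
  finally show ?thesis by simp
qed

section \<open>The map as the trace form of an algebra on four-space\<close>

text \<open>
  For \<open>D\<close> in the span of \<open>X\<^sub>1, \<dots>, X\<^sub>4\<close>, the matrix of multiplication by \<open>D\<close> in the algebra with structure constants \<open>T\<^sup>a\<^sub>d\<^sub>e\<close>: row \<open>a\<close> carries the alternated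
  form in the three indices other than \<open>a\<close>, with the sign of the complementary minor.
\<close>

definition mult_matrix :: "complex^5^5^4 \<Rightarrow> complex^5^5 \<Rightarrow> complex^4^4" where
  "mult_matrix X D = (\<chi> a e. (vector
     [alt_form D (X$e) (X$2) (X$3) (X$4), - alt_form D (X$e) (X$1) (X$3) (X$4),
      alt_form D (X$e) (X$1) (X$2) (X$4), - alt_form D (X$e) (X$1) (X$2) (X$3)] :: complex^4) $ a)"

lemma V_nth: "X \<in> V \<Longrightarrow> X $ k \<in> Alt5"
  by (simp add: V_def)

lemma mult_matrix_symmetric:
  assumes "X \<in> V"
  shows "mult_matrix X (X$d) $ a $ e = mult_matrix X (X$e) $ a $ d"
  using exhaust_4[of a]
  by (auto simp: mult_matrix_def vector_4 alt_form_commute[OF V_nth[OF assms] V_nth[OF assms] V_nth[OF assms], of "X$d" "X$e"])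

lemma mult_matrix_trace:
  assumes "X \<in> V"
  shows "mult_matrix X (X$4) $ 4 $ e = - mult_matrix X (X$1) $ 1 $ e - mult_matrix X (X$2) $ 2 $ e - mult_matrix X (X$3) $ 3 $ e"
  using alt_form_trace[of "X$1" "X$e" "X$2" "X$3" "X$4"]
  by (simp add: mult_matrix_def vector_4 algebra_simps)

lemma alt_form_eq_mult_matrix:
  "alt_form D (X$e) (X$2) (X$3) (X$4) = mult_matrix X D $ 1 $ e"
  "alt_form D (X$e) (X$1) (X$3) (X$4) = - mult_matrix X D $ 2 $ e"
  "alt_form D (X$e) (X$1) (X$2) (X$4) = mult_matrix X D $ 3 $ e"
  "alt_form D (X$e) (X$1) (X$2) (X$3) = - mult_matrix X D $ 4 $ e"
  by (simp_all add: mult_matrix_def vector_4)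

lemma alt_form_sort:
  fixes X :: "complex^5^5^4"
  shows
  "alt_form D E (X$2) (X$1) R = - alt_form D E (X$1) (X$2) R"
  "alt_form D E (X$3) (X$1) R = - alt_form D E (X$1) (X$3) R"
  "alt_form D E (X$4) (X$1) R = - alt_form D E (X$1) (X$4) R"
  "alt_form D E (X$3) (X$2) R = - alt_form D E (X$2) (X$3) R"
  "alt_form D E (X$4) (X$2) R = - alt_form D E (X$2) (X$4) R"
  "alt_form D E (X$4) (X$3) R = - alt_form D E (X$3) (X$4) R"
  "alt_form D E P (X$2) (X$1) = - alt_form D E P (X$1) (X$2)"
  "alt_form D E P (X$3) (X$1) = - alt_form D E P (X$1) (X$3)"
  "alt_form D E P (X$4) (X$1) = - alt_form D E P (X$1) (X$4)"
  "alt_form D E P (X$3) (X$2) = - alt_form D E P (X$2) (X$3)"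
  "alt_form D E P (X$4) (X$2) = - alt_form D E P (X$2) (X$4)"
  "alt_form D E P (X$4) (X$3) = - alt_form D E P (X$3) (X$4)"
  by (rule alt_form_swap)+

lemma bracket_eq_alt_form:
  assumes "X \<in> V"
  shows "bracket X i j k l m = (alt_form (X$j) (X$m) (X$i) (X$k) (X$l) + alt_form (X$i) (X$m) (X$j) (X$k) (X$l)
     + alt_form (X$j) (X$l) (X$i) (X$k) (X$m) + alt_form (X$i) (X$l) (X$j) (X$k) (X$m)) / 10"
  using five_form_eq_alt_form[OF V_nth[OF assms, of i] V_nth[OF assms, of j] V_nth[OF assms, of k] V_nth[OF assms, of l] V_nth[OF assms, of m]]
  by (simp add: bracket_eq_five_form mult.commute)

text \<open>
  All brackets are written in the structure constants. Their symmetry and the four trace relations leave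
  thirty-six independent ones, and in these both identities hold as identities of quadratic polynomials.
\<close>

lemma
  assumes "X \<in> V"
  shows phi11_eq_trace: "phi11 (bracket X) = - 4 * trace (mult_matrix X (X$1) ** mult_matrix X (X$1))"
    and phi12_eq_trace: "phi12 (bracket X) = - 4 * trace (mult_matrix X (X$1) ** mult_matrix X (X$2))"
proof -
  define T where "T a d e = mult_matrix X (X$d) $ a $ e" for a d e
  have T: "mult_matrix X (X$d) $ a $ e = T a d e" for a d e
    by (simp add: T_def)
  have sym: "T a 2 1 = T a 1 2" "T a 3 1 = T a 1 3" "T a 4 1 = T a 1 4"
    "T a 3 2 = T a 2 3" "T a 4 2 = T a 2 4" "T a 4 3 = T a 3 4" for a
    unfolding T_def by (rule mult_matrix_symmetric[OF assms])+
  have tr: "T 4 1 4 = - T 1 1 1 - T 2 1 2 - T 3 1 3"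
    "T 4 2 4 = - T 1 1 2 - T 2 2 2 - T 3 2 3"
    "T 4 3 4 = - T 1 1 3 - T 2 2 3 - T 3 3 3"
    "T 4 4 4 = - T 1 1 4 - T 2 2 4 - T 3 3 4"
    using mult_matrix_trace[OF assms, of 1] mult_matrix_trace[OF assms, of 2]
      mult_matrix_trace[OF assms, of 3] mult_matrix_trace[OF assms, of 4]
    by (simp_all add: T sym)
  show "phi11 (bracket X) = - 4 * trace (mult_matrix X (X$1) ** mult_matrix X (X$1))"
    unfolding phi11_def bracket_eq_alt_form[OF assms] trace_def matrix_matrix_mult_def
      sum_4 vec_lambda_beta
    by (simp only: alt_form_sort alt_form_same alt_form_eq_mult_matrix T sym tr minus_zero minus_minus add_0_left add_0_right)
      (simp add: field_simps power2_eq_square)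
  show "phi12 (bracket X) = - 4 * trace (mult_matrix X (X$1) ** mult_matrix X (X$2))"
    unfolding phi12_def bracket_eq_alt_form[OF assms] trace_def matrix_matrix_mult_def
      sum_4 vec_lambda_beta
    by (simp only: alt_form_sort alt_form_same alt_form_eq_mult_matrix T sym tr minus_zero minus_minus add_0_left add_0_right)
      (simp add: field_simps power2_eq_square)
qed

section \<open>Change of basis in four-space\<close>

definition lin_comb :: "complex^4 \<Rightarrow> complex^5^5^4 \<Rightarrow> complex^5^5" where
  "lin_comb u X = (\<Sum>j\<in>UNIV. map_matrix ((*) (u$j)) (X$j))"

lemma lin_comb_nth: "lin_comb u X $ p $ q = (\<Sum>j\<in>UNIV. u$j * X$j$p$q)"
  by (simp add: lin_comb_def map_matrix_def)

lemma rho_one: "rho (mat 1, B) X $ k = lin_comb (B$k) X"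
  by (simp add: rho_def lin_comb_def transpose_mat)

lemma beta_add_right: "beta X (Y + Y') = beta X Y + beta X Y'"
  by (simp add: beta_commute[of X] beta_add_left)

lemma beta_scale_right: "beta X (map_matrix ((*) c) Y) = c *s beta X Y"
  by (simp add: beta_commute[of X] beta_scale_left)

lemma five_form_add:
  "five_form (D + D') P Q R E = five_form D P Q R E + five_form D' P Q R E"
  "five_form D (P + P') Q R E = five_form D P Q R E + five_form D P' Q R E"
  "five_form D P (Q + Q') R E = five_form D P Q R E + five_form D P Q' R E"
  "five_form D P Q (R + R') E = five_form D P Q R E + five_form D P Q R' E"
  "five_form D P Q R (E + E') = five_form D P Q R E + five_form D P Q R E'"
  unfolding five_form_def
  by (simp_all add: beta_add_left beta_add_right matrix_vector_mult_def scalar_product_def sum.distrib algebra_simps)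

lemma five_form_scale:
  "five_form (map_matrix ((*) c) D) P Q R E = c * five_form D P Q R E"
  "five_form D (map_matrix ((*) c) P) Q R E = c * five_form D P Q R E"
  "five_form D P (map_matrix ((*) c) Q) R E = c * five_form D P Q R E"
  "five_form D P Q (map_matrix ((*) c) R) E = c * five_form D P Q R E"
  "five_form D P Q R (map_matrix ((*) c) E) = c * five_form D P Q R E"
  unfolding five_form_def beta_scale_left beta_scale_right
  by (simp_all add: matrix_vector_mult_def scalar_product_def
      sum_distrib_left map_matrix_def algebra_simps)

lemma alt_form_add:
  "alt_form (D + D') E P Q R = alt_form D E P Q R + alt_form D' E P Q R"
  "alt_form D (E + E') P Q R = alt_form D E P Q R + alt_form D E' P Q R"
  "alt_form D E (P + P') Q R = alt_form D E P Q R + alt_form D E P' Q R"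
  "alt_form D E P (Q + Q') R = alt_form D E P Q R + alt_form D E P Q' R"
  "alt_form D E P Q (R + R') = alt_form D E P Q R + alt_form D E P Q R'"
  unfolding alt_form_def five_form_add by (simp_all add: algebra_simps)

lemma alt_form_scale:
  "alt_form (map_matrix ((*) c) D) E P Q R = c * alt_form D E P Q R"
  "alt_form D (map_matrix ((*) c) E) P Q R = c * alt_form D E P Q R"
  "alt_form D E (map_matrix ((*) c) P) Q R = c * alt_form D E P Q R"
  "alt_form D E P (map_matrix ((*) c) Q) R = c * alt_form D E P Q R"
  "alt_form D E P Q (map_matrix ((*) c) R) = c * alt_form D E P Q R"
  unfolding alt_form_def five_form_scale by (simp_all add: algebra_simps)

lemma alt_form_lin_comb_left:
  "alt_form (lin_comb u X) E P Q R = (\<Sum>j\<in>UNIV. u$j * alt_form (X$j) E P Q R)"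
  "alt_form D (lin_comb u X) P Q R = (\<Sum>j\<in>UNIV. u$j * alt_form D (X$j) P Q R)"
  unfolding lin_comb_def sum_4 alt_form_add alt_form_scale by simp_all

text \<open>
  Since the three inner slots alternate, only the \<open>3 \<times> 3\<close> minors of the coefficient rows survive.
\<close>

lemma alt_form_lin_comb:
  "alt_form D E (lin_comb u X) (lin_comb v X) (lin_comb w X) =
     (u$2 * (v$3 * w$4 - v$4 * w$3) - u$3 * (v$2 * w$4 - v$4 * w$2) + u$4 * (v$2 * w$3 - v$3 * w$2)) * alt_form D E (X$2) (X$3) (X$4)
   + (u$1 * (v$3 * w$4 - v$4 * w$3) - u$3 * (v$1 * w$4 - v$4 * w$1) + u$4 * (v$1 * w$3 - v$3 * w$1)) * alt_form D E (X$1) (X$3) (X$4)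
   + (u$1 * (v$2 * w$4 - v$4 * w$2) - u$2 * (v$1 * w$4 - v$4 * w$1) + u$4 * (v$1 * w$2 - v$2 * w$1)) * alt_form D E (X$1) (X$2) (X$4)
   + (u$1 * (v$2 * w$3 - v$3 * w$2) - u$2 * (v$1 * w$3 - v$3 * w$1) + u$3 * (v$1 * w$2 - v$2 * w$1)) * alt_form D E (X$1) (X$2) (X$3)"
  unfolding lin_comb_def sum_4 alt_form_add alt_form_scale
  by (simp add: alt_form_sort alt_form_same algebra_simps)

lemma mult_matrix_lin_comb: "mult_matrix X (lin_comb u X) $ a $ e = (\<Sum>d\<in>UNIV. u$d * mult_matrix X (X$d) $ a $ e)"
  using exhaust_4[of a] by (auto simp: mult_matrix_def vector_4 alt_form_lin_comb_left sum_4 algebra_simps)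

text \<open>
  The rows of the multiplication matrix transform by complementary minors of \<open>B\<close>, that is by \<open>det B\<close> times
  the inverse transpose; multiplying with the transpose of \<open>B\<close> is Laplace expansion and avoids inverses.
\<close>

lemma mult_matrix_basis_change:
  assumes "\<And>k. Y $ k = lin_comb (B $ k) X"
  shows "transpose B ** mult_matrix Y D = map_matrix ((*) (det B)) (mult_matrix X D ** transpose B)"
proof -
  have "(\<Sum>a\<in>UNIV. B$a$c * mult_matrix Y D $ a $ e) = det B * (\<Sum>j\<in>UNIV. mult_matrix X D $ c $ j * B$e$j)" for c e
  proof -
    have "(\<Sum>a\<in>UNIV. B$a$c * mult_matrix Y D $ a $ e) =
        B$1$c * alt_form D (Y$e) (Y$2) (Y$3) (Y$4) - B$2$c * alt_form D (Y$e) (Y$1) (Y$3) (Y$4)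
      + B$3$c * alt_form D (Y$e) (Y$1) (Y$2) (Y$4) - B$4$c * alt_form D (Y$e) (Y$1) (Y$2) (Y$3)"
      by (simp add: sum_4 mult_matrix_def vector_4)
    also have "\<dots> = det B * (vector
     [alt_form D (Y$e) (X$2) (X$3) (X$4), - alt_form D (Y$e) (X$1) (X$3) (X$4),
      alt_form D (Y$e) (X$1) (X$2) (X$4), - alt_form D (Y$e) (X$1) (X$2) (X$3)] :: complex^4) $ c"
      unfolding assms[of 1] assms[of 2] assms[of 3] assms[of 4] alt_form_lin_comb det_4
      using exhaust_4[of c] by (elim disjE; simp only: vector_4; simp only: algebra_simps; simp)
    also have "\<dots> = det B * (\<Sum>j\<in>UNIV. mult_matrix X D $ c $ j * B$e$j)"
      using exhaust_4[of c]
      by (auto simp: assms[of e] alt_form_lin_comb_left mult_matrix_def vector_4 sum_4 algebra_simps)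
    finally show ?thesis .
  qed
  then show ?thesis
    by (simp add: vec_eq_iff matrix_matrix_mult_def transpose_def map_matrix_def)
qed

definition trace_form :: "complex^5^5^4 \<Rightarrow> complex^5^5 \<Rightarrow> complex^5^5 \<Rightarrow> complex" where
  "trace_form X C D = trace (mult_matrix X C ** mult_matrix X D)"

lemma trace_form_commute: "trace_form X C D = trace_form X D C"
  unfolding trace_form_def by (rule trace_mul_sym)

lemma trace_form_lin_comb:
  "trace_form X (lin_comb u X) (lin_comb v X) = (\<Sum>s\<in>UNIV. \<Sum>t\<in>UNIV. u$s * v$t * trace_form X (X$s) (X$t))"
  unfolding trace_form_def trace_def matrix_matrix_mult_def
  by (simp add: mult_matrix_lin_comb sum_4 algebra_simps)

lemma trace_form_basis_change:
  assumes Y: "\<And>k. Y $ k = lin_comb (B $ k) X" and "invertible B"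
  shows "trace_form Y C D = det B ^ 2 * trace_form X C D"
proof -
  obtain B' where B': "B ** B' = mat 1" "B' ** B = mat 1"
    using \<open>invertible B\<close> unfolding invertible_def by blast
  have t: "transpose B ** transpose B' = mat 1" "transpose B' ** transpose B = mat 1"
    using B' by (simp_all add: matrix_transpose_mul[symmetric] transpose_mat)
  have scale: "M ** map_matrix ((*) c) N = map_matrix ((*) c) (M ** N)"
    "map_matrix ((*) c) M ** N = map_matrix ((*) c) (M ** N)" for c and M N :: "complex^4^4"
    by (simp_all add: vec_eq_iff matrix_matrix_mult_def map_matrix_def sum_distrib_left algebra_simps)
  have Y': "mult_matrix Y C = map_matrix ((*) (det B)) (transpose B' ** mult_matrix X C ** transpose B)" for C
  proof -
    have "mult_matrix Y C = transpose B' ** (transpose B ** mult_matrix Y C)"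
      by (simp add: matrix_mul_assoc t)
    also have "\<dots> = map_matrix ((*) (det B)) (transpose B' ** mult_matrix X C ** transpose B)"
      by (simp add: mult_matrix_basis_change[OF Y] scale matrix_mul_assoc)
    finally show ?thesis .
  qed
  have "mult_matrix Y C ** mult_matrix Y D =
      map_matrix ((*) (det B)) (map_matrix ((*) (det B)) (transpose B' ** (mult_matrix X C ** (transpose B ** transpose B') ** mult_matrix X D ** transpose B)))"
    by (simp add: Y' scale matrix_mul_assoc)
  also have "\<dots> = map_matrix ((*) (det B ^ 2)) (transpose B' ** (mult_matrix X C ** mult_matrix X D ** transpose B))"
    by (simp add: t vec_eq_iff map_matrix_def power2_eq_square)
  finally have "trace_form Y C D = trace (map_matrix ((*) (det B ^ 2)) (transpose B' ** (mult_matrix X C ** mult_matrix X D ** transpose B)))"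
    by (simp add: trace_form_def)
  also have "\<dots> = det B ^ 2 * trace (transpose B' ** (mult_matrix X C ** mult_matrix X D ** transpose B))"
    by (simp add: trace_def map_matrix_def sum_distrib_left)
  also have "trace (transpose B' ** (mult_matrix X C ** mult_matrix X D ** transpose B)) =
      trace (mult_matrix X C ** mult_matrix X D ** (transpose B ** transpose B'))"
    by (subst trace_mul_sym) (simp add: matrix_mul_assoc)
  finally show ?thesis
    by (simp add: t trace_form_def)
qed

lemma lin_comb_axis: "lin_comb (axis k 1) X = X $ k"
  by (simp add: vec_eq_iff lin_comb_nth axis_def if_distrib[of "\<lambda>x. x * _"] cong: if_cong)

text \<open>
  Permuting the indices of the brackets is the change of basis by a permutation matrix, whose
  determinant has square one.
\<close>

lemma phi_permuted:
  assumes "X \<in> V" "bij \<sigma>"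
  shows "phi11 (perm_bracket \<sigma> (bracket X)) = - 4 * trace_form X (X $ inv \<sigma> 1) (X $ inv \<sigma> 1)"
    and "phi12 (perm_bracket \<sigma> (bracket X)) = - 4 * trace_form X (X $ inv \<sigma> 1) (X $ inv \<sigma> 2)"
proof -
  define Y where "Y = (\<chi> k. X $ inv \<sigma> k)"
  define B :: "complex^4^4" where "B = (\<chi> k. axis (inv \<sigma> k) 1)"
  have Yk: "Y $ k = lin_comb (B $ k) X" for k
    by (simp add: Y_def B_def lin_comb_axis)
  have "inj (inv \<sigma>)"
    using assms(2) by (simp add: bij_imp_bij_inv bij_is_inj)
  then have "B ** transpose B = mat 1"
    by (auto simp: vec_eq_iff matrix_matrix_mult_def transpose_def B_def mat_def axis_def inj_eq
        if_distrib[of "\<lambda>x. x * _"] cong: if_cong)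
  then have "det B * det B = 1" and inv: "invertible B"
    by (metis det_I det_mul det_transpose, metis invertible_right_inverse)
  then have trace_form: "trace_form Y C D = trace_form X C D" for C D
    by (simp add: trace_form_basis_change[OF Yk inv] power2_eq_square)
  have "Y \<in> V" and perm: "perm_bracket \<sigma> (bracket X) = bracket Y"
    using assms(1) by (simp_all add: V_def Y_def perm_bracket_def bracket_def fun_eq_iff)
  have Y1: "Y $ 1 = X $ inv \<sigma> 1" and Y2: "Y $ 2 = X $ inv \<sigma> 2"
    by (simp_all add: Y_def)
  show "phi11 (perm_bracket \<sigma> (bracket X)) = - 4 * trace_form X (X $ inv \<sigma> 1) (X $ inv \<sigma> 1)"
    unfolding perm phi11_eq_trace[OF \<open>Y \<in> V\<close>] trace_form_def[symmetric] trace_form Y1 ..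
  show "phi12 (perm_bracket \<sigma> (bracket X)) = - 4 * trace_form X (X $ inv \<sigma> 1) (X $ inv \<sigma> 2)"
    unfolding perm phi12_eq_trace[OF \<open>Y \<in> V\<close>] trace_form_def[symmetric] trace_form Y1 Y2 ..
qed

lemma ex_bij_prescribed:
  fixes s t :: 4
  assumes "s \<noteq> t"
  shows "\<exists>\<sigma> :: 4 \<Rightarrow> 4. bij \<sigma> \<and> inv \<sigma> 1 = s \<and> inv \<sigma> 2 = t"
proof -
  define \<tau> :: "4 \<Rightarrow> 4" where
    "\<tau> = Transposition.transpose (Transposition.transpose 1 s 2) t \<circ> Transposition.transpose 1 s"
  have "bij \<tau>"
    unfolding \<tau>_def by (intro bij_comp bij_transpose)
  moreover have "\<tau> 1 = s" "\<tau> 2 = t"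
    using assms by (auto simp: \<tau>_def Transposition.transpose_def)
  ultimately show ?thesis
    by (intro exI[of _ "inv \<tau>"]) (simp add: bij_imp_bij_inv inv_inv_eq)
qed

lemma Phi_eq_trace_form:
  assumes "X \<in> V"
  shows "Phi X $ s $ t = - 4 * trace_form X (X$s) (X$t)"
proof (cases "s = t")
  case True
  have "inv (Transposition.transpose 1 s) 1 = s"
    by simp
  with True show ?thesis
    by (simp add: Phi_def phi_permuted(1)[OF assms bij_transpose])
next
  case False
  define \<sigma> :: "4 \<Rightarrow> 4" where "\<sigma> = (SOME \<sigma>. bij \<sigma> \<and> inv \<sigma> 1 = s \<and> inv \<sigma> 2 = t)"
  have "bij \<sigma> \<and> inv \<sigma> 1 = s \<and> inv \<sigma> 2 = t"
    unfolding \<sigma>_def by (rule someI_ex[OF ex_bij_prescribed[OF False]])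
  with False show ?thesis
    by (simp add: Phi_def phi_permuted(2)[OF assms] flip: \<sigma>_def)
qed

lemma Alt5_iff: "X \<in> Alt5 \<longleftrightarrow> (\<forall>i j. X$j$i = - X$i$j)"
  by (simp add: Alt5_def vec_eq_iff transpose_def)

lemma Alt5_congruence:
  assumes "X \<in> Alt5"
  shows "A ** X ** transpose A \<in> Alt5"
proof -
  have "transpose (A ** X ** transpose A) = A ** transpose X ** transpose A"
    by (simp add: matrix_transpose_mul matrix_mul_assoc)
  also have "\<dots> = - (A ** X ** transpose A)"
    using assms by (simp add: Alt5_def vec_eq_iff matrix_matrix_mult_def sum_negf)
  finally show ?thesis
    by (simp add: Alt5_def)
qed

lemma rho_nth: "rho (A, B) X $ k $ p $ q = (\<Sum>j\<in>UNIV. B$k$j * (A ** X$j ** transpose A) $ p $ q)"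
  by (simp add: rho_def map_matrix_def)

lemma rho_in_V:
  assumes "X \<in> V"
  shows "rho g X \<in> V"
proof -
  obtain A B where g: "g = (A, B)" by (cases g)
  have *: "(A ** X$j ** transpose A) $ q $ p = - (A ** X$j ** transpose A) $ p $ q" for j p q
    using Alt5_congruence[OF V_nth[OF assms]] unfolding Alt5_iff by blast
  have "rho g X $ k $ q $ p = - rho g X $ k $ p $ q" for k p q
    unfolding g rho_nth sum_negf[symmetric] by (subst *) simp
  then show ?thesis
    unfolding V_def mem_Collect_eq Alt5_iff by blast
qed

lemma Phi_basis_change:
  assumes "X \<in> V" "invertible B"
  shows "Phi (rho (mat 1, B) X) = map_matrix ((*) (det B ^ 2)) (B ** Phi X ** transpose B)"
proof -
  have "Phi (rho (mat 1, B) X) $ s $ t = det B ^ 2 * (\<Sum>q\<in>UNIV. (\<Sum>p\<in>UNIV. B$s$p * Phi X $ p $ q) * B$t$q)" for s t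
  proof -
    have "Phi (rho (mat 1, B) X) $ s $ t =
        - 4 * (det B ^ 2 * trace_form X (lin_comb (B$s) X) (lin_comb (B$t) X))"
      unfolding Phi_eq_trace_form[OF rho_in_V[OF assms(1)]] trace_form_basis_change[OF rho_one assms(2)] rho_one ..
    also have "\<dots> = det B ^ 2 * (\<Sum>p\<in>UNIV. \<Sum>q\<in>UNIV. B$s$p * Phi X $ p $ q * B$t$q)"
      unfolding trace_form_lin_comb Phi_eq_trace_form[OF assms(1)] sum_distrib_left by (intro sum.cong) auto
    also have "\<dots> = det B ^ 2 * (\<Sum>q\<in>UNIV. (\<Sum>p\<in>UNIV. B$s$p * Phi X $ p $ q) * B$t$q)"
      by (subst sum.swap) (simp add: sum_distrib_right)
    finally show ?thesis .
  qed
  then show ?thesis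
    by (simp add: vec_eq_iff matrix_matrix_mult_def transpose_def map_matrix_def)
qed

section \<open>Generation of the general linear group\<close>

definition transvection :: "'n \<Rightarrow> 'n \<Rightarrow> 'a::field \<Rightarrow> 'a^'n^'n" where
  "transvection m n c = (\<chi> i j. of_bool (i = j) + (if i = m \<and> j = n then c else 0))"

definition dilation :: "'n \<Rightarrow> 'a::field \<Rightarrow> 'a^'n^'n" where
  "dilation k s = (\<chi> i j. if i = j then (if i = k then s else 1) else 0)"

lemma transvection_mult: "(transvection m n c ** A) $ i $ j = A$i$j + (if i = m then c * A$n$j else 0)"
proof -
  have "(transvection m n c ** A) $ i $ j =
      (\<Sum>k\<in>UNIV. (if k = i then A$k$j else 0) + (if k = n then (if i = m then c * A$k$j else 0) else 0))"
    unfolding matrix_matrix_mult_def transvection_def vec_lambda_beta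
    by (rule sum.cong) (auto simp: algebra_simps)
  then show ?thesis
    by (simp add: sum.distrib)
qed

lemma mult_transvection: "(A ** transvection m n c) $ i $ j = A$i$j + (if j = n then c * A$i$m else 0)"
proof -
  have "(A ** transvection m n c) $ i $ j =
      (\<Sum>k\<in>UNIV. (if k = j then A$i$k else 0) + (if k = m then (if j = n then c * A$i$k else 0) else 0))"
    unfolding matrix_matrix_mult_def transvection_def vec_lambda_beta
    by (rule sum.cong) (auto simp: algebra_simps)
  then show ?thesis
    by (simp add: sum.distrib)
qed

lemma dilation_mult: "(dilation k s ** A) $ i $ j = (if i = k then s * A$i$j else A$i$j)"
proof -
  have "(dilation k s ** A) $ i $ j = (\<Sum>l\<in>UNIV. if l = i then (if i = k then s * A$l$j else A$l$j) else 0)"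
    unfolding matrix_matrix_mult_def dilation_def vec_lambda_beta by (rule sum.cong) auto
  then show ?thesis by simp
qed

lemma mult_dilation: "(A ** dilation k s) $ i $ j = (if j = k then s * A$i$j else A$i$j)"
proof -
  have "(A ** dilation k s) $ i $ j = (\<Sum>l\<in>UNIV. if l = j then (if j = k then s * A$i$l else A$i$l) else 0)"
    unfolding matrix_matrix_mult_def dilation_def vec_lambda_beta by (rule sum.cong) auto
  then show ?thesis by simp
qed

lemma transvection_inverse: "m \<noteq> n \<Longrightarrow> transvection m n (- c) ** transvection m n c = mat 1"
  by (simp add: vec_eq_iff transvection_mult) (auto simp: transvection_def mat_def)

lemma dilation_inverse: "s \<noteq> 0 \<Longrightarrow> dilation k (1 / s) ** dilation k s = mat 1"
  by (simp add: vec_eq_iff dilation_mult) (auto simp: dilation_def mat_def)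

lemma dilation_1: "dilation k 1 = mat 1"
  by (auto simp: dilation_def mat_def vec_eq_iff)

lemma det_dilation: "det (dilation k s) = s"
proof -
  have "det (dilation k s) = (\<Prod>i\<in>UNIV. dilation k s $ i $ i)"
    by (rule det_diagonal) (simp add: dilation_def)
  then show ?thesis by (simp add: dilation_def)
qed

lemma det_transvection:
  assumes "m \<noteq> n"
  shows "det (transvection m n c) = 1"
proof -
  have *: "transvection m n c = (\<chi> k. if k = m then row m (mat 1) + c *s row n (mat 1) else row k (mat 1))"
    using assms by (auto simp: transvection_def vec_eq_iff row_def mat_def)
  show ?thesis
    using det_row_operation[OF assms, of "mat 1" c] by (simp add: *)
qed

text \<open>
  Gaussian elimination. A transvection or dilation on the left can be removed again, because its inverse is of
  the same kind, so it suffices to reduce the matrix to the identity by row operations.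
\<close>

lemma general_linear_induct [consumes 1, case_names mult transvection dilation]:
  fixes A :: "'a::field^'n^'n"
  assumes "det A \<noteq> 0"
    and mult: "\<And>A B. \<lbrakk>P A; P B\<rbrakk> \<Longrightarrow> P (A ** B)"
    and transvec: "\<And>m n c. m \<noteq> n \<Longrightarrow> P (transvection m n c)"
    and dil: "\<And>k s. s \<noteq> 0 \<Longrightarrow> P (dilation k s)"
  shows "P A"
proof -
  have id: "P (mat 1)"
    using dil[of 1] by (simp add: dilation_1)
  have un_transvec: "P A" if "P (transvection m n c ** A)" "m \<noteq> n" for A m n c
  proof -
    have "A = transvection m n (- c) ** (transvection m n c ** A)"
      by (simp add: matrix_mul_assoc transvection_inverse that)
    then show ?thesis
      using mult[OF transvec that(1)] that(2) by metis
  qed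
  have un_dil: "P A" if "P (dilation k s ** A)" "s \<noteq> 0" for A k s
  proof -
    have "A = dilation k (1 / s) ** (dilation k s ** A)"
      by (simp add: matrix_mul_assoc dilation_inverse that)
    then show ?thesis
      using mult[OF dil that(1)] that(2) by (metis divide_eq_0_iff zero_neq_one)
  qed
  \<comment> \<open>The columns outside \<open>K\<close> are already those of the identity matrix.\<close>
  have "P A" if "finite K" "det A \<noteq> 0" "\<And>i j. j \<notin> K \<Longrightarrow> A$i$j = of_bool (i = j)" for A K
    using that
  proof (induction arbitrary: A rule: finite_induct)
    case empty
    then have "A = mat 1"
      by (simp add: vec_eq_iff mat_def)
    then show ?case using id by simp
  next
    case (insert k K)
    have clear: "P B" if "finite L" "det B \<noteq> 0" "B$k$k = 1" "\<And>i j. j \<notin> insert k K \<Longrightarrow> B$i$j = of_bool (i = j)"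
        "\<And>i. i \<notin> L \<Longrightarrow> i \<noteq> k \<Longrightarrow> B$i$k = 0" for B L
      using that
    proof (induction arbitrary: B rule: finite_induct)
      case empty
      show ?case
      proof (rule insert.IH)
        show "B$i$j = of_bool (i = j)" if "j \<notin> K" for i j
          using empty that by (cases "j = k"; cases "i = k") auto
      qed fact
    next
      case (insert l L)
      show ?case
      proof (cases "l = k")
        case True
        with insert show ?thesis by (metis insertE)
      next
        case False
        let ?C = "transvection l k (- B$l$k) ** B"
        have "P ?C"
        proof (rule insert.IH)
          show "det ?C \<noteq> 0"
            using insert.prems False by (simp add: det_mul det_transvection)
          show "?C$k$k = 1"
            using insert.prems False by (simp add: transvection_mult)
          show "?C$i$j = of_bool (i = j)" if "j \<notin> Set.insert k K" for i j
            using insert.prems that by (auto simp: transvection_mult)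
          show "?C$i$k = 0" if "i \<notin> L" "i \<noteq> k" for i
            using insert.prems that by (auto simp: transvection_mult)
        qed
        then show ?thesis
          using False by (rule un_transvec)
      qed
    qed
    have scaled: "P B" if "det B \<noteq> 0" "B$k$k \<noteq> 0" "\<And>i j. j \<notin> insert k K \<Longrightarrow> B$i$j = of_bool (i = j)" for B
    proof (rule un_dil[of k "1 / B$k$k"])
      show "P (dilation k (1 / B$k$k) ** B)"
        using that by (intro clear[of UNIV]) (auto simp: det_mul det_dilation dilation_mult)
    qed (use that in simp)
    show ?case
    proof (cases "A$k$k = 0")
      case False
      then show ?thesis using scaled insert.prems by blast
    next
      case True
      \<comment> \<open>If the column k vanished on the rows still to be treated, it would depend on the columns already normalised.\<close>
      have "\<exists>l\<in>K. A$l$k \<noteq> 0"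
      proof (rule ccontr)
        assume *: "\<not> (\<exists>l\<in>K. A$l$k \<noteq> 0)"
        define v where "v = (\<chi> j. if j = k then 1 else if j \<in> K then 0 else - A$j$k)"
        have "(A *v v) $ i = 0" for i
        proof -
          have "(A *v v) $ i = (\<Sum>j\<in>UNIV. (if j = k then A$i$j else 0) + (if j = i \<and> i \<noteq> k \<and> i \<notin> K then - A$i$k else 0))"
            unfolding matrix_vector_mult_def v_def vec_lambda_beta
            using insert.prems(2) by (intro sum.cong) auto
          also have "\<dots> = A$i$k + (if i \<noteq> k \<and> i \<notin> K then - A$i$k else 0)"
            by (simp add: sum.distrib)
          finally show ?thesis
            using * True by auto
        qed
        then have "A *v v = 0" by (simp add: vec_eq_iff)
        moreover have "invertible A"
          using insert.prems(1) by (simp add: invertible_det_nz)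
        ultimately have "v = 0"
          by (metis invertible_def matrix_vector_mul_assoc matrix_vector_mul_lid matrix_vector_mult_0_right)
        then have "v $ k = 0" by simp
        then show False by (simp add: v_def)
      qed
      then obtain l where l: "l \<in> K" "A$l$k \<noteq> 0" by blast
      then have "k \<noteq> l" using insert.hyps by blast
      have "P (transvection k l 1 ** A)"
        using l insert.prems True \<open>k \<noteq> l\<close>
        by (intro scaled) (auto simp: det_mul det_transvection transvection_mult)
      then show ?thesis
        using \<open>k \<noteq> l\<close> by (rule un_transvec)
    qed
  qed
  from this[of UNIV A] show ?thesis
    using assms(1) by simp
qed

section \<open>Invariance under the special linear group of five-space\<close>

lemma transpose_transvection: "transpose (transvection m n c) = transvection n m c"
  by (auto simp: transvection_def transpose_def vec_eq_iff)

lemma transpose_dilation: "transpose (dilation k s) = dilation k s"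
  by (auto simp: dilation_def transpose_def vec_eq_iff)

lemma transvection_mult_vector: "(transvection m n c *v v) $ i = v$i + (if i = m then c * v$n else 0)"
proof -
  have "(transvection m n c *v v) $ i =
      (\<Sum>k\<in>UNIV. (if k = i then v$k else 0) + (if k = n then (if i = m then c * v$k else 0) else 0))"
    unfolding matrix_vector_mult_def transvection_def vec_lambda_beta
    by (rule sum.cong) (auto simp: algebra_simps)
  then show ?thesis
    by (simp add: sum.distrib)
qed

lemma dilation_mult_vector: "(dilation k s *v v) $ i = (if i = k then s * v$i else v$i)"
proof -
  have "(dilation k s *v v) $ i = (\<Sum>l\<in>UNIV. if l = i then (if i = k then s * v$l else v$l) else 0)"
    unfolding matrix_vector_mult_def dilation_def vec_lambda_beta by (rule sum.cong) auto
  then show ?thesis by simp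
qed

text \<open>
  On \<open>SL\<^sub>5\<close> the form \<open>\<beta>\<close> takes values in the dual of five-space, being the exterior product into the fourth exterior power.
  The identity is multiplicative in \<open>A\<close>, so generators suffice.
\<close>

lemma beta_congruence:
  assumes "det A \<noteq> 0" "X \<in> Alt5" "Y \<in> Alt5"
  shows "transpose A *v beta (A ** X ** transpose A) (A ** Y ** transpose A) = det A *s beta X Y"
proof -
  have "\<forall>X\<in>Alt5. \<forall>Y\<in>Alt5.
      transpose A *v beta (A ** X ** transpose A) (A ** Y ** transpose A) = det A *s beta X Y"
    using assms(1)
  proof (induction rule: general_linear_induct)
    case (mult A B)
    show ?case
    proof (intro ballI)
      fix X Y assume XY: "X \<in> Alt5" "Y \<in> Alt5"
      have *: "A ** B ** X ** transpose (A ** B) = A ** (B ** X ** transpose B) ** transpose A" for X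
        by (simp add: matrix_transpose_mul matrix_mul_assoc)
      have "transpose (A ** B) *v beta (A ** B ** X ** transpose (A ** B)) (A ** B ** Y ** transpose (A ** B))
          = transpose B *v (transpose A *v beta (A ** (B ** X ** transpose B) ** transpose A) (A ** (B ** Y ** transpose B) ** transpose A))"
        unfolding * unfolding matrix_transpose_mul matrix_vector_mul_assoc ..
      also have "\<dots> = det A *s (det B *s beta X Y)"
        using mult XY by (simp add: Alt5_congruence vector_scalar_commute)
      finally show "transpose (A ** B) *v beta (A ** B ** X ** transpose (A ** B)) (A ** B ** Y ** transpose (A ** B))
          = det (A ** B) *s beta X Y"
        by (simp add: det_mul vec_eq_iff)
    qed
  next
    case (transvection m n c)
    show ?case
    proof (intro ballI)
      fix X Y assume X: "X \<in> Alt5" and Y: "Y \<in> Alt5"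
      show "transpose (transvection m n c) *v beta (transvection m n c ** X ** transpose (transvection m n c))
             (transvection m n c ** Y ** transpose (transvection m n c)) = det (transvection m n c) *s beta X Y"
        unfolding det_transvection[OF transvection] transpose_transvection
        using exhaust_5[of m] exhaust_5[of n] transvection
        by (elim disjE; hypsubst; simp add: vec_eq_iff forall_5 beta_nth transvection_mult mult_transvection
            transvection_mult_vector Alt5_lower[OF X] Alt5_lower[OF Y]; simp add: algebra_simps)
    qed
  next
    case (dilation k s)
    show ?case
    proof (intro ballI)
      fix X Y assume X: "X \<in> Alt5" and Y: "Y \<in> Alt5"
      show "transpose (dilation k s) *v beta (dilation k s ** X ** transpose (dilation k s))
             (dilation k s ** Y ** transpose (dilation k s)) = det (dilation k s) *s beta X Y"
        unfolding det_dilation transpose_dilation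
        using exhaust_5[of k]
        by (elim disjE; hypsubst; simp add: vec_eq_iff forall_5 beta_nth dilation_mult mult_dilation
            dilation_mult_vector; simp add: algebra_simps)
    qed
  qed
  then show ?thesis using assms by blast
qed

lemma scalar_product_transpose: "scalar_product u (A *v v) = scalar_product (transpose A *v u) v"
  for A :: "complex^'n^'m"
proof -
  have "(\<Sum>i\<in>UNIV. \<Sum>j\<in>UNIV. u$i * (A$i$j * v$j)) = (\<Sum>j\<in>UNIV. \<Sum>i\<in>UNIV. A$i$j * u$i * v$j)"
    by (subst sum.swap) (simp add: algebra_simps)
  then show ?thesis
    by (simp add: scalar_product_def matrix_vector_mult_def transpose_def sum_distrib_left sum_distrib_right)
qed

lemma rho_of_one: "rho (A, mat 1) X $ k = A ** X$k ** transpose A"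
  by (simp add: vec_eq_iff rho_nth mat_def if_distrib[of "\<lambda>x. x * _"] cong: if_cong)

lemma bracket_special:
  assumes "X \<in> V" "det A = 1"
  shows "bracket (rho (A, mat 1) X) = bracket X"
proof (intro ext)
  fix i j k l m
  let ?Y = "rho (A, mat 1) X"
  have \<beta>: "transpose A *v beta (?Y$p) (?Y$q) = beta (X$p) (X$q)" for p q
    using beta_congruence[OF _ V_nth[OF assms(1)] V_nth[OF assms(1)], of A p q] assms(2)
    by (simp add: rho_of_one)
  have "bracket ?Y i j k l m =
      scalar_product (beta (?Y$i) (?Y$j)) (A *v (X$k *v (transpose A *v beta (?Y$l) (?Y$m))))"
    unfolding bracket_def rho_of_one[of A X k] matrix_vector_mul_assoc matrix_mul_assoc ..
  also have "\<dots> = bracket X i j k l m"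
    unfolding scalar_product_transpose[of _ A] \<beta> bracket_def ..
  finally show "bracket ?Y i j k l m = bracket X i j k l m" .
qed

lemma congruence_nth:
  "(A ** Z ** transpose A) $ p $ q = (\<Sum>(r, s)\<in>UNIV. A$p$s * Z$s$r * A$q$r)"
  for A Z :: "complex^'n^'n"
  by (simp add: matrix_matrix_mult_def transpose_def sum_distrib_right sum.cartesian_product flip: UNIV_Times_UNIV)

lemma rho_mult: "rho (A ** A', B ** B') X = rho (A, B) (rho (A', B') X)"
proof -
  have "rho (A, B) (rho (A', B') X) $ k $ p $ q = rho (A ** A', B ** B') X $ k $ p $ q" for k p q
  proof -
    have conj: "(A ** rho (A', B') X $ j ** transpose A) $ p $ q =
        (\<Sum>l\<in>UNIV. B'$j$l * (A ** A' ** X$l ** transpose (A ** A')) $ p $ q)" for j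
    proof -
      have "(A ** rho (A', B') X $ j ** transpose A) $ p $ q =
          (\<Sum>(r, s)\<in>UNIV. \<Sum>l\<in>UNIV. A$p$s * (B'$j$l * (A' ** X$l ** transpose A') $ s $ r) * A$q$r)"
        unfolding congruence_nth rho_nth sum_distrib_left sum_distrib_right by simp
      also have "\<dots> = (\<Sum>l\<in>UNIV. B'$j$l * (\<Sum>(r, s)\<in>UNIV. A$p$s * (A' ** X$l ** transpose A') $ s $ r * A$q$r))"
        unfolding case_prod_unfold by (subst sum.swap) (simp add: sum_distrib_left algebra_simps)
      also have "\<dots> = (\<Sum>l\<in>UNIV. B'$j$l * (A ** (A' ** X$l ** transpose A') ** transpose A) $ p $ q)"
        unfolding congruence_nth ..
      finally show ?thesis
        by (simp add: matrix_transpose_mul matrix_mul_assoc)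
    qed
    have "rho (A, B) (rho (A', B') X) $ k $ p $ q =
        (\<Sum>j\<in>UNIV. \<Sum>l\<in>UNIV. B$k$j * B'$j$l * (A ** A' ** X$l ** transpose (A ** A')) $ p $ q)"
      by (simp add: rho_nth conj sum_distrib_left mult.assoc)
    also have "\<dots> = rho (A ** A', B ** B') X $ k $ p $ q"
      by (subst sum.swap) (simp add: rho_nth matrix_matrix_mult_def[of B] sum_distrib_right)
    finally show ?thesis .
  qed
  then show ?thesis by (simp add: vec_eq_iff)
qed

lemma Phi_rho:
  assumes "X \<in> V" "det A = 1" "invertible B"
  shows "Phi (rho (A, B) X) = map_matrix ((*) (det B ^ 2)) (B ** Phi X ** transpose B)"
proof -
  have "rho (A, B) X = rho (mat 1, B) (rho (A, mat 1) X)"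
    using rho_mult[of "mat 1" A B "mat 1" X] by simp
  moreover have "Phi (rho (A, mat 1) X) = Phi X"
    unfolding Phi_def bracket_special[OF assms(1,2)] ..
  ultimately show ?thesis
    by (simp add: Phi_basis_change[OF rho_in_V[OF assms(1)] assms(3)])
qed

lemma det_Phi_rho:
  assumes "X \<in> V" "det A = 1" "invertible B"
  shows "det (Phi (rho (A, B) X)) = det B ^ 10 * det (Phi X)"
proof -
  have "map_matrix ((*) c) M = mat c ** M" for c and M :: "complex^4^4"
    by (simp add: vec_eq_iff matrix_matrix_mult_def mat_def map_matrix_def if_distrib[of "\<lambda>x. x * _"] cong: if_cong)
  moreover have "det (mat c :: complex^4^4) = c ^ 4" for c
    by (subst det_diagonal) (auto simp: mat_def)
  ultimately show ?thesis
    by (simp add: Phi_rho[OF assms] det_mul det_transpose power_mult[symmetric] flip: power_add)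
      (simp add: eval_nat_numeral)
qed

section \<open>Nonvanishing polynomials on the general linear group\<close>

text \<open>
  A product of transvections that exchanges two basis vectors up to sign. It conjugates the dilations of
  these two vectors into each other.
\<close>

definition signed_swap :: "'n \<Rightarrow> 'n \<Rightarrow> 'a::field^'n^'n" where
  "signed_swap i j = transvection i j 1 ** transvection j i (- 1) ** transvection i j 1"

lemma mult_signed_swap:
  assumes "i \<noteq> j"
  shows "(A ** signed_swap i j) $ r $ c = (if c = i then - A$r$j else if c = j then A$r$i else A$r$c)"
  using assms by (auto simp: signed_swap_def matrix_mul_assoc mult_transvection)

lemma signed_swap_dilation:
  assumes "i \<noteq> j"
  shows "signed_swap i j ** dilation j s = dilation i s ** signed_swap i j"
proof -
  have "signed_swap i j = mat 1 ** signed_swap i j" by simp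
  then have *: "signed_swap i j $ r $ c =
      (if c = i then - mat 1 $ r $ j else if c = j then mat 1 $ r $ i else mat 1 $ r $ c)" for r c
    using mult_signed_swap[OF assms] by metis
  show ?thesis
    using assms by (auto simp: vec_eq_iff mult_dilation dilation_mult * mat_def)
qed

definition transvection_invariant :: "('a::field^'n^'n \<Rightarrow> 'b) \<Rightarrow> bool" where
  "transvection_invariant h \<longleftrightarrow>
     (\<forall>A m n c. det A \<noteq> 0 \<longrightarrow> m \<noteq> n \<longrightarrow> h (A ** transvection m n c) = h A)"

lemma transvection_dilation:
  "s \<noteq> 0 \<Longrightarrow> m \<noteq> n \<Longrightarrow> transvection m n c ** dilation k s =
     dilation k s ** transvection m n (if k = n then s * c else if k = m then c / s else c)"
  by (auto simp: vec_eq_iff transvection_mult mult_transvection mult_dilation dilation_mult)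
    (auto simp: transvection_def dilation_def)

lemma transvection_invariant_dilation:
  fixes h :: "'a::field^'n^'n \<Rightarrow> 'b"
  assumes "transvection_invariant h" "s \<noteq> 0"
  shows "transvection_invariant (\<lambda>A. h (A ** dilation k s))"
  unfolding transvection_invariant_def
proof (intro allI impI)
  fix A :: "'a^'n^'n" and m n :: 'n and c
  assume A: "det A \<noteq> 0" and mn: "m \<noteq> n"
  have "A ** transvection m n c ** dilation k s =
      (A ** dilation k s) ** transvection m n (if k = n then s * c else if k = m then c / s else c)"
    using transvection_dilation[OF assms(2) mn] by (metis matrix_mul_assoc)
  moreover have "det (A ** dilation k s) \<noteq> 0"
    using A assms(2) by (simp add: det_mul det_dilation)
  ultimately show "h (A ** transvection m n c ** dilation k s) = h (A ** dilation k s)"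
    using assms(1) mn unfolding transvection_invariant_def by metis
qed

lemma transvection_invariant_signed_swap:
  assumes "transvection_invariant h" "i \<noteq> j" "det A \<noteq> 0"
  shows "h (A ** signed_swap i j) = h A"
  using assms unfolding transvection_invariant_def signed_swap_def
  by (simp add: matrix_mul_assoc det_mul det_transvection)

lemma transvection_invariant_dilation_eq:
  assumes h: "transvection_invariant h" and "s \<noteq> 0" "det A \<noteq> 0"
  shows "h (A ** dilation i s) = h (A ** dilation j s)"
proof (cases "i = j")
  case False
  have "h (A ** dilation i s) = h (A ** dilation i s ** signed_swap i j)"
    using transvection_invariant_signed_swap[OF h False] assms by (simp add: det_mul det_dilation)
  also have "A ** dilation i s ** signed_swap i j = A ** signed_swap i j ** dilation j s"
    using signed_swap_dilation[OF False] by (metis matrix_mul_assoc)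
  also have "h \<dots> = h (A ** dilation j s)"
    using transvection_invariant_signed_swap[OF transvection_invariant_dilation[OF h] False] assms by blast
  finally show ?thesis .
qed simp

text \<open>
  Modulo transvections a matrix is a single dilation. The statement is proved for all invariant functions at
  once, because moving a dilation to the right replaces \<open>h\<close> by another invariant function.
\<close>

lemma transvection_invariant_det:
  fixes A :: "'a::field^'n^'n"
  assumes "det A \<noteq> 0" "transvection_invariant h" "det C \<noteq> 0"
  shows "h (C ** A) = h (C ** dilation k (det A))"
proof -
  have "det A \<noteq> 0 \<and> (\<forall>(h :: 'a^'n^'n \<Rightarrow> 'b) C. transvection_invariant h \<longrightarrow> det C \<noteq> 0 \<longrightarrow> h (C ** A) = h (C ** dilation k (det A)))"
    using assms(1)
  proof (induction rule: general_linear_induct)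
    case (mult A B)
    have "h (C ** (A ** B)) = h (C ** dilation k (det (A ** B)))"
      if h: "transvection_invariant h" and C: "det C \<noteq> 0" for h :: "'a^'n^'n \<Rightarrow> 'b" and C
    proof -
      have "h (C ** (A ** B)) = h (C ** A ** B)"
        by (simp add: matrix_mul_assoc)
      also have "\<dots> = h (C ** A ** dilation k (det B))"
        using mult h C by (simp add: det_mul)
      also have "\<dots> = h (C ** dilation k (det A) ** dilation k (det B))"
        using mult transvection_invariant_dilation[OF h] C by blast
      also have "C ** dilation k (det A) ** dilation k (det B) = C ** dilation k (det (A ** B))"
        by (auto simp: vec_eq_iff mult_dilation det_mul)
      finally show ?thesis .
    qed
    then show ?case using mult by (simp add: det_mul)
  next
    case (transvection m n c)
    then show ?case
      by (auto simp: det_transvection dilation_1 transvection_invariant_def)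
  next
    case (dilation l s)
    then show ?case
      using transvection_invariant_dilation_eq by (auto simp: det_dilation)
  qed
  then show ?thesis using assms by blast
qed

lemma poly_nonvanishing_constant:
  fixes q :: "complex poly"
  assumes "\<And>t. poly q t \<noteq> 0"
  shows "poly q t = poly q s"
  using fundamental_theorem_of_algebra[of q] assms by (auto simp: constant_def)

lemma poly_nonvanishing_monomial:
  fixes q :: "complex poly"
  assumes "\<And>t. t \<noteq> 0 \<Longrightarrow> poly q t \<noteq> 0"
  shows "\<exists>n. \<forall>t. poly q t = poly q 1 * t ^ n"
proof -
  have "q \<noteq> 0" using assms[of 1] by auto
  obtain r where r: "q = [:- 0, 1:] ^ order 0 q * r" "\<not> [:- 0, 1:] dvd r"
    using order_decomp[OF \<open>q \<noteq> 0\<close>, of 0] by blast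
  have pq: "poly q t = t ^ order 0 q * poly r t" for t
    by (subst r(1)) (simp add: poly_power)
  have "poly r t \<noteq> 0" for t
  proof (cases "t = 0")
    case True
    then show ?thesis using r(2) by (simp add: poly_eq_0_iff_dvd)
  next
    case False
    then show ?thesis using assms[OF False] pq by auto
  qed
  from poly_nonvanishing_constant[OF this] have "poly r t = poly r 1" for t .
  then show ?thesis
    using pq by (intro exI[of _ "order 0 q"]) (metis mult.commute mult_1 power_one)
qed

text \<open>
  Transvections and dilations both move a matrix along an affine line. On a line of the first kind \<open>h\<close> has
  no zero and is constant; on a line of the second kind through the identity it vanishes at most at the singular
  matrix, so it is a monomial.
\<close>

lemma nonvanishing_polynomial_on_GL:
  fixes h :: "complex^'n^'n \<Rightarrow> complex"
  assumes poly: "\<And>M N. \<exists>q. \<forall>t. h (\<chi> i j. M$i$j + t * N$i$j) = poly q t"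
    and nz: "\<And>A. det A \<noteq> 0 \<Longrightarrow> h A \<noteq> 0"
  shows "\<exists>n. \<forall>A. det A \<noteq> 0 \<longrightarrow> h A = h (mat 1) * det A ^ n"
proof -
  have inv: "transvection_invariant h"
    unfolding transvection_invariant_def
  proof (intro allI impI)
    fix A :: "complex^'n^'n" and m n :: 'n and c
    assume A: "det A \<noteq> 0" and mn: "m \<noteq> n"
    have *: "A ** transvection m n t = (\<chi> i j. A$i$j + t * (\<chi> i j. if j = n then A$i$m else 0)$i$j)" for t
      by (simp add: vec_eq_iff mult_transvection)
    obtain q where q: "\<And>t. h (A ** transvection m n t) = poly q t"
      using poly[of A "\<chi> i j. if j = n then A$i$m else 0"] unfolding * by blast
    have "poly q t \<noteq> 0" for t
      using nz[of "A ** transvection m n t"] A mn by (simp add: q det_mul det_transvection)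
    then have "poly q c = poly q 0"
      by (rule poly_nonvanishing_constant)
    moreover have "A ** transvection m n 0 = A"
      by (simp add: vec_eq_iff mult_transvection)
    ultimately show "h (A ** transvection m n c) = h A"
      by (metis q)
  qed
  obtain k :: 'n where True by simp
  have *: "dilation k s = (\<chi> i j. dilation k 0 $ i $ j + s * (\<chi> i j. if i = k \<and> j = k then 1 else 0) $ i $ j)" for s :: complex
    by (auto simp: vec_eq_iff dilation_def)
  obtain q where q: "\<And>s. h (dilation k s) = poly q s"
    using poly[of "dilation k 0" "\<chi> i j. if i = k \<and> j = k then 1 else 0"] unfolding * [symmetric] by blast
  have "poly q s \<noteq> 0" if "s \<noteq> 0" for s
    using nz[of "dilation k s"] that by (simp add: q det_dilation)
  then obtain n where n: "\<And>s. poly q s = poly q 1 * s ^ n"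
    using poly_nonvanishing_monomial by blast
  have "h A = h (mat 1) * det A ^ n" if "det A \<noteq> 0" for A
  proof -
    have "h A = h (dilation k (det A))"
      using transvection_invariant_det[OF that inv, of "mat 1" k] by simp
    also have "\<dots> = h (dilation k 1) * det A ^ n"
      using n q by metis
    finally show ?thesis by (simp add: dilation_1)
  qed
  then show ?thesis by blast
qed

section \<open>A two-parameter family of points\<close>

definition wedge :: "5 \<Rightarrow> 5 \<Rightarrow> complex^5^5" where
  "wedge i j = (\<chi> r s. of_bool (r = i \<and> s = j) - of_bool (r = j \<and> s = i))"

text \<open>
  The family was chosen so sparse that each multiplication matrix has at most four nonzero entries, and such that
  the determinant of \<open>\<Phi>\<close> is linear in \<open>t\<close>. The corner entries of \<open>\<Phi>\<close> do not depend on \<open>p\<close>, and its inner block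
  vanishes with \<open>p\<close>; so the two parameters switch a plane and a line on and off.
\<close>

definition sample :: "complex \<Rightarrow> complex \<Rightarrow> complex^5^5^4" where
  "sample p t = vector [wedge 1 5 + wedge 3 4, wedge 2 3 + wedge 4 5,
     map_matrix ((*) p) (wedge 1 3) + wedge 2 5, wedge 1 4 + map_matrix ((*) t) (wedge 3 5)]"

lemma wedge_nth: "wedge i j $ r $ s = of_bool (r = i \<and> s = j) - of_bool (r = j \<and> s = i)"
  by (simp add: wedge_def)

lemma sample_nth:
  "sample p t $ 1 = wedge 1 5 + wedge 3 4"
  "sample p t $ 2 = wedge 2 3 + wedge 4 5"
  "sample p t $ 3 = map_matrix ((*) p) (wedge 1 3) + wedge 2 5"
  "sample p t $ 4 = wedge 1 4 + map_matrix ((*) t) (wedge 3 5)"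
  by (simp_all add: sample_def vector_4)

lemma sample_in_V: "sample p t \<in> V"
  unfolding V_def mem_Collect_eq Alt5_iff forall_4
  by (simp add: sample_nth wedge_nth map_matrix_def algebra_simps)

lemma beta_sample:
  "beta (sample p t $ 1) (sample p t $ 1) = vector [0, - 2, 0, 0, 0]"
  "beta (sample p t $ 1) (sample p t $ 2) = vector [0, 0, 0, - 1, 0]"
  "beta (sample p t $ 1) (sample p t $ 3) = vector [1, 0, 0, 0, 0]"
  "beta (sample p t $ 1) (sample p t $ 4) = vector [0, 0, 0, 0, 0]"
  "beta (sample p t $ 2) (sample p t $ 2) = vector [2, 0, 0, 0, 0]"
  "beta (sample p t $ 2) (sample p t $ 3) = vector [0, - p, 0, 0, 0]"
  "beta (sample p t $ 2) (sample p t $ 4) = vector [0, 0, 0, 0, 1]"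
  "beta (sample p t $ 3) (sample p t $ 3) = vector [0, 0, 0, 2 * p, 0]"
  "beta (sample p t $ 3) (sample p t $ 4) = vector [0, 0, - 1, 0, 0]"
  "beta (sample p t $ 4) (sample p t $ 4) = vector [0, 2 * t, 0, 0, 0]"
  unfolding vec_eq_iff forall_5 beta_nth vector_5 sample_nth
  by (simp_all add: wedge_nth map_matrix_def)

lemma beta_sample_swap:
  "beta (sample p t $ 2) (sample p t $ 1) = beta (sample p t $ 1) (sample p t $ 2)"
  "beta (sample p t $ 3) (sample p t $ 1) = beta (sample p t $ 1) (sample p t $ 3)"
  "beta (sample p t $ 4) (sample p t $ 1) = beta (sample p t $ 1) (sample p t $ 4)"
  "beta (sample p t $ 3) (sample p t $ 2) = beta (sample p t $ 2) (sample p t $ 3)"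
  "beta (sample p t $ 4) (sample p t $ 2) = beta (sample p t $ 2) (sample p t $ 4)"
  "beta (sample p t $ 4) (sample p t $ 3) = beta (sample p t $ 3) (sample p t $ 4)"
  by (rule beta_commute)+

lemma mult_matrix_sample:
  "mult_matrix (sample p t) (sample p t $ 1) = vector [vector [- 2, 0, 0, 0], vector [0, 4, 0, 0], vector [0, 0, 4, 0], vector [0, 0, 0, - 6]]"
  "mult_matrix (sample p t) (sample p t $ 2) = vector [vector [0, 0, - 10 * p, 0], vector [4, 0, 0, 0], vector [0, - 10, 0, 0], vector [0, 0, 0, 0]]"
  "mult_matrix (sample p t) (sample p t $ 3) = vector [vector [0, - 10 * p, 0, 0], vector [0, 0, 10 * p, 0], vector [4, 0, 0, 0], vector [0, 0, 0, 0]]"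
  "mult_matrix (sample p t) (sample p t $ 4) = vector [vector [0, 0, 0, - 10 * t], vector [0, 0, 0, 0], vector [0, 0, 0, 0], vector [- 6, 0, 0, 0]]"
  unfolding vec_eq_iff forall_4 mult_matrix_def vec_lambda_beta vector_4 alt_form_def five_form_def beta_sample_swap beta_sample
  unfolding scalar_product_def matrix_vector_mult_def sum_5 vec_lambda_beta vector_5 sample_nth
  by (simp_all add: wedge_nth map_matrix_def)

lemma Phi_sample:
  "Phi (sample p t) = vector [vector [- 288, 0, 0, 0], vector [0, 0, 720 * p, 0],
     vector [0, 720 * p, 0, 0], vector [0, 0, 0, - 480 * t]]"
  unfolding vec_eq_iff forall_4 Phi_eq_trace_form[OF sample_in_V] trace_form_def mult_matrix_sample trace_def matrix_matrix_mult_def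
    sum_4 vec_lambda_beta vector_4
  by simp

text \<open>
  Up to sign the constant is \<open>288 \<cdot> 720\<^sup>2 \<cdot> 480\<close>.
\<close>

lemma det_Phi_sample: "det (Phi (sample p t)) = - 71663616000 * p ^ 2 * t"
  unfolding Phi_sample det_4 vector_4 by (simp add: power2_eq_square)

lemma Phi_zero: "Phi 0 = 0"
proof -
  have "bracket 0 i j k l m = 0" for i j k l m
    by (simp add: bracket_def scalar_product_def)
  then show ?thesis
    by (simp add: vec_eq_iff Phi_def phi11_def phi12_def perm_bracket_def)
qed

section \<open>Congruence of symmetric matrices and surjectivity\<close>

definition congruent_to :: "complex^'n^'n \<Rightarrow> complex^'n^'n \<Rightarrow> bool" where
  "congruent_to S S' \<longleftrightarrow> (\<exists>C. det C \<noteq> 0 \<and> S' = C ** S ** transpose C)"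

lemma congruent_to_refl: "congruent_to S S"
  unfolding congruent_to_def by (rule exI[of _ "mat 1"]) (simp add: transpose_mat)

lemma congruent_to_trans:
  assumes "congruent_to S S'" "congruent_to S' S''"
  shows "congruent_to S S''"
proof -
  obtain C D where "det C \<noteq> 0" "S' = C ** S ** transpose C" "det D \<noteq> 0" "S'' = D ** S' ** transpose D"
    using assms unfolding congruent_to_def by blast
  then show ?thesis
    unfolding congruent_to_def
    by (intro exI[of _ "D ** C"]) (simp add: det_mul matrix_transpose_mul matrix_mul_assoc)
qed

lemma congruent_to_sym:
  assumes "congruent_to S S'"
  shows "congruent_to S' S"
proof -
  obtain C where C: "det C \<noteq> 0" "S' = C ** S ** transpose C"
    using assms unfolding congruent_to_def by blast
  then obtain D where D: "C ** D = mat 1" "D ** C = mat 1"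
    by (metis invertible_def invertible_det_nz)
  then have "transpose C ** transpose D = mat 1"
    by (simp add: matrix_transpose_mul[symmetric] transpose_mat)
  then have "D ** S' ** transpose D = S"
    unfolding C by (metis D(2) matrix_mul_assoc matrix_mul_lid matrix_mul_rid)
  moreover have "det D \<noteq> 0"
    using D by (metis det_I det_mul mult_zero_right zero_neq_one)
  ultimately show ?thesis
    unfolding congruent_to_def by blast
qed

lemma symmetric_congruence:
  fixes S C :: "complex^'n^'n"
  assumes "transpose S = S"
  shows "transpose (C ** S ** transpose C) = C ** S ** transpose C"
  using assms by (simp add: matrix_transpose_mul matrix_mul_assoc)

text \<open>
  Lagrange's reduction of a quadratic form: a nonzero diagonal entry clears its row and column, and if the
  diagonal is zero then adding one row and column to another creates such an entry, as the characteristic is not two.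
\<close>

lemma symmetric_congruent_to_diagonal:
  fixes S :: "complex^'n^'n"
  assumes "transpose S = S"
  shows "\<exists>D. congruent_to S D \<and> (\<forall>i j. i \<noteq> j \<longrightarrow> D$i$j = 0)"
proof -
  \<comment> \<open>The rows and columns outside \<open>K\<close> are already diagonal.\<close>
  have "\<exists>D. congruent_to S D \<and> (\<forall>i j. i \<noteq> j \<longrightarrow> D$i$j = 0)"
    if "finite K" "transpose S = S" "\<And>i j. i \<noteq> j \<Longrightarrow> j \<notin> K \<Longrightarrow> S$i$j = 0" for K and S :: "complex^'n^'n"
    using that
  proof (induction K arbitrary: S rule: finite_psubset_induct)
    case (psubset K)
    have sym: "S$j$i = S$i$j" if "transpose S = S" for i j and S :: "complex^'n^'n"
    proof -
      have "transpose S $ i $ j = S $ i $ j" using that by simp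
      then show ?thesis by (simp only: transpose_def vec_lambda_beta)
    qed
    have pivot: "\<exists>D. congruent_to S D \<and> (\<forall>i j. i \<noteq> j \<longrightarrow> D$i$j = 0)"
      if S: "transpose S = S" "\<And>i j. i \<noteq> j \<Longrightarrow> j \<notin> K \<Longrightarrow> S$i$j = 0" and k: "k \<in> K" "S$k$k \<noteq> 0"
      for k and S :: "complex^'n^'n"
    proof -
      define E :: "complex \<Rightarrow> complex^'n^'n" where
        "E c = (\<chi> i j. of_bool (i = j) + (if j = k \<and> i \<noteq> k then c * (S$i$k / S$k$k) else 0))" for c
      have E_mult: "(E c ** M) $ i $ j = M$i$j + (if i \<noteq> k then c * (S$i$k / S$k$k) * M$k$j else 0)" for c i j and M :: "complex^'n^'n"
      proof -
        have "(E c ** M) $ i $ j =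
          (\<Sum>l\<in>UNIV. (if l = i then M$l$j else 0) + (if l = k then (if i \<noteq> k then c * (S$i$k / S$k$k) * M$l$j else 0) else 0))"
          unfolding matrix_matrix_mult_def E_def vec_lambda_beta by (rule sum.cong) (auto simp: algebra_simps)
        then show ?thesis by (simp add: sum.distrib)
      qed
      have mult_E: "(M ** transpose (E c)) $ i $ j = M$i$j + (if j \<noteq> k then c * (S$j$k / S$k$k) * M$i$k else 0)" for c i j and M :: "complex^'n^'n"
      proof -
        have "(M ** transpose (E c)) $ i $ j = (E c ** transpose M) $ j $ i"
          by (simp add: matrix_matrix_mult_def transpose_def mult.commute)
        then show ?thesis by (simp add: E_mult transpose_def)
      qed
      have "E 1 ** E (- 1) = mat 1"
        by (simp add: vec_eq_iff E_mult) (auto simp: E_def mat_def)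
      then have "det (E (- 1)) \<noteq> 0"
        by (metis det_I det_mul mult_zero_right zero_neq_one)
      then have cong: "congruent_to S (E (- 1) ** S ** transpose (E (- 1)))" (is "congruent_to S ?S'")
        unfolding congruent_to_def by blast
      have S': "?S' $ i $ j = (if i = k \<and> j = k then S$k$k else if i = k \<or> j = k then 0 else S$i$j - S$i$k * S$j$k / S$k$k)" for i j
        using k sym[OF S(1), of k i] sym[OF S(1), of k j] by (auto simp: E_mult mult_E field_simps)
      have "\<exists>D. congruent_to ?S' D \<and> (\<forall>i j. i \<noteq> j \<longrightarrow> D$i$j = 0)"
      proof (rule psubset.IH)
        show "K - {k} \<subset> K" using k by blast
        show "transpose ?S' = ?S'" using S(1) by (rule symmetric_congruence)
        show "?S' $ i $ j = 0" if "i \<noteq> j" "j \<notin> K - {k}" for i j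
        proof (cases "j = k")
          case False
          then have "S$i$j = 0" "S$k$j = 0"
            using that k S(2) by auto
          then show ?thesis using that False sym[OF S(1), of k j] unfolding S' by auto
        qed (use that S' in auto)
      qed
      then show ?thesis using cong congruent_to_trans by blast
    qed
    show ?case
    proof (cases "\<exists>k\<in>K. S$k$k \<noteq> 0")
      case True
      then show ?thesis using pivot psubset.prems by blast
    next
      case no_pivot: False
      show ?thesis
      proof (cases "\<exists>i j. i \<noteq> j \<and> S$i$j \<noteq> 0")
        case True
        then obtain i j where ij: "i \<noteq> j" "S$i$j \<noteq> 0" by blast
        then have K: "i \<in> K" "j \<in> K"
          using psubset.prems(2)[of i j] psubset.prems(2)[of j i] sym[OF psubset.prems(1), of i j] by auto
        define S' where "S' = transvection i j 1 ** S ** transpose (transvection i j 1)"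
        have S': "S' $ r $ c = S$r$c + (if r = i then S$j$c else 0) + (if c = i then S$r$j + (if r = i then S$j$j else 0) else 0)" for r c
          unfolding S'_def transpose_transvection by (auto simp: transvection_mult mult_transvection)
        have cong: "congruent_to S S'"
          unfolding congruent_to_def S'_def using det_transvection[OF ij(1), of "1::complex"] by (metis zero_neq_one)
        have "\<exists>D. congruent_to S' D \<and> (\<forall>i j. i \<noteq> j \<longrightarrow> D$i$j = 0)"
        proof (rule pivot)
          show "transpose S' = S'" unfolding S'_def using psubset.prems(1) by (rule symmetric_congruence)
          show "S' $ r $ c = 0" if "r \<noteq> c" "c \<notin> K" for r c
          proof -
            have "c \<noteq> i" "j \<noteq> c" using that K by auto
            then show ?thesis
              using psubset.prems(2)[of r c] psubset.prems(2)[of j c] that by (simp add: S')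
          qed
          show "S' $ i $ i \<noteq> 0"
            using no_pivot K ij sym[OF psubset.prems(1), of i j] unfolding S' by auto
        qed (rule K)
        then show ?thesis using cong congruent_to_trans by blast
      next
        case False
        then show ?thesis using congruent_to_refl by blast
      qed
    qed
  qed
  from this[of UNIV S] show ?thesis using assms by simp
qed

definition unit_diag :: "'n set \<Rightarrow> complex^'n^'n" where
  "unit_diag U = (\<chi> i j. of_bool (i = j \<and> i \<in> U))"

lemma diagonal_congruent_to_unit_diag:
  assumes "\<And>i j. i \<noteq> j \<Longrightarrow> D$i$j = 0"
  shows "congruent_to D (unit_diag {i. D$i$i \<noteq> 0})"
proof -
  define c where "c i = (if D$i$i = 0 then 1 else 1 / csqrt (D$i$i))" for i
  define C where "C = (\<chi> i j. if i = j then c i else 0)"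
  have "det C = (\<Prod>i\<in>UNIV. c i)"
    by (subst det_diagonal) (simp_all add: C_def)
  then have "det C \<noteq> 0" by (simp add: c_def)
  moreover have "(C ** D ** transpose C) $ i $ j = unit_diag {i. D$i$i \<noteq> 0} $ i $ j" for i j
  proof -
    have "(C ** D ** transpose C) $ i $ j = c i * D$i$j * c j"
      by (simp add: matrix_matrix_mult_def C_def transpose_def if_distrib[of "\<lambda>x. x * _"]
          if_distrib[of "\<lambda>x. _ * x"] cong: if_cong)
    then show ?thesis
      using assms[of i j] power2_csqrt[of "D$i$i"]
      by (cases "i = j") (auto simp: c_def unit_diag_def field_simps power2_eq_square)
  qed
  ultimately show ?thesis
    unfolding congruent_to_def by (intro exI[of _ C]) (simp add: vec_eq_iff)
qed

text \<open>
  A bijection between index sets of equal size extends to a permutation of all indices.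
\<close>

lemma unit_diag_congruent_to:
  fixes U U' :: "'n::finite set"
  assumes "card U = card U'"
  shows "congruent_to (unit_diag U) (unit_diag U')"
proof -
  obtain f where f: "bij_betw f U' U"
    using assms by (metis finite_same_card_bij finite)
  have "card (- U') = card (- U)"
    using assms by (simp add: Compl_eq_Diff_UNIV card_Diff_subset)
  then obtain g where g: "bij_betw g (- U') (- U)"
    by (metis finite_same_card_bij finite)
  define h where "h i = (if i \<in> U' then f i else g i)" for i
  have "bij_betw h (U' \<union> - U') (U \<union> - U)"
    using f g unfolding h_def by (rule bij_betw_disjoint_Un) auto
  then have h: "inj h" by (simp add: bij_def bij_betw_def)
  have hU: "h i \<in> U \<longleftrightarrow> i \<in> U'" for i
    using f g by (auto simp: h_def bij_betw_def)
  define C :: "complex^'n^'n" where "C = (\<chi> i j. of_bool (j = h i))"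
  have C_mult: "(C ** M) $ i $ j = M $ h i $ j" for M :: "complex^'n^'n" and i j
    by (simp add: matrix_matrix_mult_def C_def of_bool_def if_distrib[of "\<lambda>x. x * _"] cong: if_cong)
  have mult_C: "(M ** transpose C) $ i $ j = M $ i $ h j" for M :: "complex^'n^'n" and i j
    by (simp add: matrix_matrix_mult_def C_def of_bool_def transpose_def if_distrib[of "\<lambda>x. _ * x"] cong: if_cong)
  have "C ** transpose C = mat 1"
    using h by (simp add: vec_eq_iff mult_C) (auto simp: C_def mat_def inj_eq)
  then have "det C \<noteq> 0"
    by (metis det_I det_mul mult_zero_left zero_neq_one)
  moreover have "unit_diag U' = C ** unit_diag U ** transpose C"
    using h hU by (auto simp: vec_eq_iff mult_C C_mult unit_diag_def inj_eq)
  ultimately show ?thesis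
    unfolding congruent_to_def by metis
qed

text \<open>
  The inner block is a hyperbolic plane, diagonalised by the vectors \<open>(1,1)\<close> and \<open>(\<i>,-\<i>)\<close>.
\<close>

lemma Phi_sample_congruent_to_diagonal:
  "congruent_to (Phi (sample 1 t)) (\<chi> i j. if i = j then vector [- 288, 1440, 1440, - 480 * t] $ i else 0)"
proof -
  define C :: "complex^4^4" where
    "C = vector [vector [1, 0, 0, 0], vector [0, 1, 1, 0], vector [0, \<i>, - \<i>, 0], vector [0, 0, 0, 1]]"
  have "det C \<noteq> 0"
    unfolding det_4 C_def vector_4 by (simp add: complex_eq_iff)
  moreover have "C ** Phi (sample 1 t) ** transpose C =
      (\<chi> i j. if i = j then vector [- 288, 1440, 1440, - 480 * t] $ i else 0)"
    unfolding vec_eq_iff forall_4 matrix_matrix_mult_def transpose_def vec_lambda_beta sum_4 C_def Phi_sample vector_4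
    by simp
  ultimately show ?thesis
    unfolding congruent_to_def by metis
qed

text \<open>
  The ranks one to four are attained at the parameters \<open>(p,t) = (0,0), (0,1), (1,0), (1,1)\<close>, and rank zero at the
  origin.
\<close>

lemma ex_Phi_congruent_to_unit_diag:
  fixes U :: "4 set"
  shows "\<exists>X\<in>V. congruent_to (Phi X) (unit_diag U)"
proof -
  have via: "congruent_to S (unit_diag U)"
    if "congruent_to S (\<chi> i j. if i = j then vector [a, b, c, d] $ i else 0)"
      "card U = card {i. (vector [a, b, c, d] :: complex^4) $ i \<noteq> 0}" for S a b c d
  proof -
    let ?D = "(\<chi> i j. if i = j then vector [a, b, c, d] $ i else 0) :: complex^4^4"
    have "congruent_to ?D (unit_diag {i. ?D$i$i \<noteq> 0})"
      by (rule diagonal_congruent_to_unit_diag) simp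
    moreover have "congruent_to (unit_diag {i. ?D$i$i \<noteq> 0}) (unit_diag U)"
      using that(2) by (intro unit_diag_congruent_to) simp
    ultimately show ?thesis
      using that(1) congruent_to_trans by blast
  qed
  have nonzero: "{i. (vector [a, b, c, d] :: complex^4) $ i \<noteq> 0} =
      (if a = 0 then {} else {1}) \<union> (if b = 0 then {} else {2}) \<union> (if c = 0 then {} else {3}) \<union> (if d = 0 then {} else {4})"
    for a b c d
    unfolding set_eq_iff forall_4 mem_Collect_eq vector_4 by simp
  have diag0: "Phi (sample 0 t) = (\<chi> i j. if i = j then vector [- 288, 0, 0, - 480 * t] $ i else 0)" for t
    unfolding vec_eq_iff forall_4 Phi_sample by (simp add: vector_4)
  have "card U \<le> 4"
    using card_mono[of "UNIV :: 4 set" U] by simp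
  then consider "card U = 0" | "card U = 1" | "card U = 2" | "card U = 3" | "card U = 4"
    by linarith
  then show ?thesis
  proof cases
    case 1
    then have "unit_diag U = 0"
      by (simp add: unit_diag_def vec_eq_iff)
    moreover have "0 \<in> V" by (simp add: V_def Alt5_def vec_eq_iff transpose_def)
    ultimately show ?thesis
      using Phi_zero congruent_to_refl by metis
  next
    case 2
    have "congruent_to (Phi (sample 0 0)) (unit_diag U)"
      by (rule via[of _ "- 288" 0 0 "- 480 * 0"]) (simp_all add: diag0 congruent_to_refl nonzero 2)
    then show ?thesis using sample_in_V by blast
  next
    case 3
    have "congruent_to (Phi (sample 0 1)) (unit_diag U)"
      by (rule via[of _ "- 288" 0 0 "- 480 * 1"]) (simp_all add: diag0 congruent_to_refl nonzero 3)
    then show ?thesis using sample_in_V by blast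
  next
    case 4
    have "congruent_to (Phi (sample 1 0)) (unit_diag U)"
      by (rule via[OF Phi_sample_congruent_to_diagonal]) (simp add: nonzero 4)
    then show ?thesis using sample_in_V by blast
  next
    case 5
    have "congruent_to (Phi (sample 1 1)) (unit_diag U)"
      by (rule via[OF Phi_sample_congruent_to_diagonal]) (simp add: nonzero 5)
    then show ?thesis using sample_in_V by blast
  qed
qed

lemma Phi_in_Sym4:
  assumes "X \<in> V"
  shows "Phi X \<in> Sym4"
proof -
  have "Phi X $ j $ i = Phi X $ i $ j" for i j
    unfolding Phi_eq_trace_form[OF assms] trace_form_commute[of X "X$j" "X$i"] ..
  then show ?thesis
    unfolding Sym4_def mem_Collect_eq vec_eq_iff transpose_def vec_lambda_beta by blast
qed

text \<open>
  If \<open>S = C \<Phi>(X) C\<^sup>t\<close> then \<open>B = lC\<close> gives \<open>(det B)\<^sup>2 B \<Phi>(X) B\<^sup>t = l^10 (det C)\<^sup>2 S\<close>, so a tenth root \<open>l\<close> of \<open>(det C)\<^sup>-\<^sup>2\<close>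
  removes the scalar.
\<close>

lemma Phi_surjective: "Phi ` V = Sym4"
proof
  show "Phi ` V \<subseteq> Sym4" using Phi_in_Sym4 by blast
  show "Sym4 \<subseteq> Phi ` V"
  proof
    fix S assume "S \<in> Sym4"
    then have "transpose S = S" by (simp add: Sym4_def)
    then obtain D where D: "congruent_to S D" "\<And>i j. i \<noteq> j \<Longrightarrow> D$i$j = 0"
      using symmetric_congruent_to_diagonal[of S] by metis
    let ?U = "{i. D$i$i \<noteq> 0}"
    obtain X where X: "X \<in> V" "congruent_to (Phi X) (unit_diag ?U)"
      using ex_Phi_congruent_to_unit_diag[of ?U] by (elim bexE)
    have "congruent_to S (unit_diag ?U)"
      by (rule congruent_to_trans[OF D(1) diagonal_congruent_to_unit_diag[OF D(2)]])
    then have "congruent_to (Phi X) S"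
      by (rule congruent_to_trans[OF X(2) congruent_to_sym])
    then obtain C where C: "det C \<noteq> 0" "S = C ** Phi X ** transpose C"
      unfolding congruent_to_def by blast
    define l where "l = exp (- Ln (det C ^ 2) / 10)"
    have "l ^ 10 = exp (- Ln (det C ^ 2))"
      unfolding l_def by (simp flip: exp_of_nat_mult)
    also have "\<dots> = 1 / det C ^ 2"
      using C(1) by (simp add: exp_minus field_simps)
    finally have l10: "l ^ 10 * det C ^ 2 = 1"
      using C(1) by simp
    define B where "B = mat l ** C"
    have B_nth: "B $ i $ j = l * C $ i $ j" for i j
      by (simp add: B_def matrix_matrix_mult_def mat_def if_distrib[of "\<lambda>x. x * _"] cong: if_cong)
    have detB: "det B = l ^ 4 * det C"
      unfolding B_def det_mul by (subst det_diagonal) (auto simp: mat_def)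
    have "l \<noteq> 0" by (simp add: l_def)
    then have "invertible B"
      using C(1) by (simp add: invertible_det_nz detB)
    then have "Phi (rho (mat 1, B) X) = map_matrix ((*) (det B ^ 2)) (B ** Phi X ** transpose B)"
      by (rule Phi_basis_change[OF X(1)])
    also have "B ** Phi X ** transpose B = map_matrix ((*) (l ^ 2)) S"
      unfolding C(2) congruence_nth vec_eq_iff B_nth map_matrix_def vec_lambda_beta
      by (simp add: case_prod_unfold sum_distrib_left power2_eq_square algebra_simps)
    also have "map_matrix ((*) (det B ^ 2)) (map_matrix ((*) (l ^ 2)) S) = map_matrix ((*) (l ^ 10 * det C ^ 2)) S"
      by (simp add: vec_eq_iff map_matrix_def detB power_mult_distrib flip: power_mult power_add)
    finally have "Phi (rho (mat 1, B) X) = S"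
      by (simp add: l10 map_matrix_def vec_eq_iff)
    then show "S \<in> Phi ` V"
      using rho_in_V[OF X(1)] by blast
  qed
qed

section \<open>Polynomials and their values\<close>

lemma eval_mpoly_superset:
  assumes "finite K" "Poly_Mapping.keys p \<subseteq> K"
  shows "eval_mpoly x p = (\<Sum>m\<in>K. Poly_Mapping.lookup p m * (\<Prod>v\<in>Poly_Mapping.keys m. x v ^ Poly_Mapping.lookup m v))"
  unfolding eval_mpoly_def using assms by (intro sum.mono_neutral_left) (auto simp: in_keys_iff)

lemma eval_mpoly_add: "eval_mpoly x (p + q) = eval_mpoly x p + eval_mpoly x q"
proof -
  let ?K = "Poly_Mapping.keys p \<union> Poly_Mapping.keys q"
  have "eval_mpoly x (p + q) = (\<Sum>m\<in>?K. Poly_Mapping.lookup (p + q) m * (\<Prod>v\<in>Poly_Mapping.keys m. x v ^ Poly_Mapping.lookup m v))"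
    by (rule eval_mpoly_superset) (simp_all add: Poly_Mapping.keys_add)
  moreover have "eval_mpoly x p = (\<Sum>m\<in>?K. Poly_Mapping.lookup p m * (\<Prod>v\<in>Poly_Mapping.keys m. x v ^ Poly_Mapping.lookup m v))"
    by (rule eval_mpoly_superset) simp_all
  moreover have "eval_mpoly x q = (\<Sum>m\<in>?K. Poly_Mapping.lookup q m * (\<Prod>v\<in>Poly_Mapping.keys m. x v ^ Poly_Mapping.lookup m v))"
    by (rule eval_mpoly_superset) simp_all
  ultimately show ?thesis
    by (simp add: lookup_add distrib_right sum.distrib)
qed

lemma eval_mpoly_zero: "eval_mpoly x 0 = 0"
  by (simp add: eval_mpoly_def)

lemma eval_mpoly_sum: "eval_mpoly x (\<Sum>a\<in>A. f a) = (\<Sum>a\<in>A. eval_mpoly x (f a))"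
  by (induction A rule: infinite_finite_induct) (simp_all add: eval_mpoly_add eval_mpoly_zero)

lemma eval_mpoly_single:
  "eval_mpoly x (Poly_Mapping.single m c) = c * (\<Prod>v\<in>Poly_Mapping.keys m. x v ^ Poly_Mapping.lookup m v)"
  by (simp add: eval_mpoly_def)

lemma monomial_value_add:
  fixes m n :: "'v \<Rightarrow>\<^sub>0 nat" and x :: "'v \<Rightarrow> complex"
  shows "(\<Prod>v\<in>Poly_Mapping.keys (m + n). x v ^ Poly_Mapping.lookup (m + n) v) =
    (\<Prod>v\<in>Poly_Mapping.keys m. x v ^ Poly_Mapping.lookup m v) * (\<Prod>v\<in>Poly_Mapping.keys n. x v ^ Poly_Mapping.lookup n v)"
proof -
  let ?K = "Poly_Mapping.keys m \<union> Poly_Mapping.keys n"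
  have *: "(\<Prod>v\<in>Poly_Mapping.keys k. x v ^ Poly_Mapping.lookup k v) = (\<Prod>v\<in>?K. x v ^ Poly_Mapping.lookup k v)"
    if "Poly_Mapping.keys k \<subseteq> ?K" for k :: "'v \<Rightarrow>\<^sub>0 nat"
    using that by (intro prod.mono_neutral_left) (auto simp: in_keys_iff)
  show ?thesis
    unfolding *[OF Un_upper1] *[OF Un_upper2] *[OF Poly_Mapping.keys_add]
    by (simp only: lookup_add power_add prod.distrib)
qed

lemma sum_monomials: "(\<Sum>m\<in>Poly_Mapping.keys p. Poly_Mapping.single m (Poly_Mapping.lookup p m)) = p"
  by (rule poly_mapping_eqI) (simp add: lookup_sum lookup_single when_def in_keys_iff)

lemma eval_mpoly_mult: "eval_mpoly x (p * q) = eval_mpoly x p * eval_mpoly x q"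
proof -
  have "p * q = (\<Sum>m\<in>Poly_Mapping.keys p. Poly_Mapping.single m (Poly_Mapping.lookup p m)) *
      (\<Sum>n\<in>Poly_Mapping.keys q. Poly_Mapping.single n (Poly_Mapping.lookup q n))"
    unfolding sum_monomials ..
  also have "\<dots> = (\<Sum>m\<in>Poly_Mapping.keys p. \<Sum>n\<in>Poly_Mapping.keys q.
      Poly_Mapping.single (m + n) (Poly_Mapping.lookup p m * Poly_Mapping.lookup q n))"
    by (simp add: sum_product mult_single)
  finally show ?thesis
    by (simp add: eval_mpoly_sum eval_mpoly_single monomial_value_add)
      (simp add: eval_mpoly_def sum_product algebra_simps)
qed

lemma eval_const_mpoly: "eval_mpoly x (const_mpoly c) = c"
  by (simp add: const_mpoly_def eval_mpoly_single)

lemma eval_mpoly_one: "eval_mpoly x 1 = 1"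
  using eval_const_mpoly[of x 1] by (simp add: const_mpoly_def)

lemma eval_mpoly_power: "eval_mpoly x (p ^ n) = eval_mpoly x p ^ n"
  by (induction n) (simp_all add: eval_mpoly_one eval_mpoly_mult)

lemma eval_mpoly_curve: "\<exists>q. \<forall>t. eval_mpoly (\<lambda>v. poly (c v) t) P = poly q t"
  unfolding eval_mpoly_def
  by (rule exI[of _ "\<Sum>m\<in>Poly_Mapping.keys P. [:Poly_Mapping.lookup P m:] * (\<Prod>v\<in>Poly_Mapping.keys m. c v ^ Poly_Mapping.lookup m v)"])
    (simp add: poly_sum poly_prod poly_power)

text \<open>
  One indeterminate at a time: for fixed values of the others the sum is a polynomial in the chosen
  indeterminate with infinitely many zeros, so its coefficients vanish, and these are sums of the same
  shape over the exponents with a prescribed entry. The exponents are indexed by an arbitrary type, since the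
  restriction to a smaller set of indeterminates is then no change of data.
\<close>

lemma exponents_vanish:
  fixes c :: "'m \<Rightarrow> complex" and e :: "'m \<Rightarrow> 'v \<Rightarrow> nat"
  assumes "finite W" "finite M" "\<And>m m'. \<lbrakk>m \<in> M; m' \<in> M; \<And>v. v \<in> W \<Longrightarrow> e m v = e m' v\<rbrakk> \<Longrightarrow> m = m'"
    and "\<And>x. (\<Sum>m\<in>M. c m * (\<Prod>v\<in>W. x v ^ e m v)) = 0" and "m0 \<in> M"
  shows "c m0 = 0"
  using assms
proof (induction W arbitrary: M rule: finite_induct)
  case empty
  then have "M = {m0}" by auto
  then show ?case using empty.prems(3) by simp
next
  case (insert w W)
  \<comment> \<open>The exponents that contribute to the same power of the indeterminate \<open>w\<close> as \<open>m0\<close>.\<close>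
  let ?M = "{m \<in> M. e m w = e m0 w}"
  show ?case
  proof (rule insert.IH[of ?M])
    show "finite ?M" "m0 \<in> ?M" using insert.prems by auto
    show "m = m'" if "m \<in> ?M" "m' \<in> ?M" "\<And>v. v \<in> W \<Longrightarrow> e m v = e m' v" for m m'
      using that by (intro insert.prems(2)) auto
    show "(\<Sum>m\<in>?M. c m * (\<Prod>v\<in>W. x v ^ e m v)) = 0" for x
    proof -
      define q where "q = (\<Sum>m\<in>M. monom (c m * (\<Prod>v\<in>W. x v ^ e m v)) (e m w))"
      have "poly q t = 0" for t
      proof -
        have "(\<Prod>v\<in>W. (x(w := t)) v ^ e m v) = (\<Prod>v\<in>W. x v ^ e m v)" for m
          using insert.hyps by (intro prod.cong) auto
        then show ?thesis
          using insert.prems(3)[of "x(w := t)"] insert.hyps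
          by (simp add: q_def poly_sum poly_monom algebra_simps)
      qed
      then have "q = 0"
        using poly_all_0_iff_0 by blast
      then have "coeff q (e m0 w) = 0" by simp
      moreover have "coeff q (e m0 w) = (\<Sum>m\<in>M. if e m w = e m0 w then c m * (\<Prod>v\<in>W. x v ^ e m v) else 0)"
        by (simp add: q_def coeff_sum)
      ultimately show ?thesis
        using insert.prems(1) by (simp add: sum.inter_filter)
    qed
  qed
qed

lemma mpoly_vanish:
  fixes p :: "'v mpoly"
  assumes "\<And>x. eval_mpoly x p = 0"
  shows "p = 0"
proof -
  let ?W = "\<Union>m\<in>Poly_Mapping.keys p. Poly_Mapping.keys m"
  have "Poly_Mapping.lookup p m = 0" if m: "m \<in> Poly_Mapping.keys p" for m
  proof (rule exponents_vanish[of ?W "Poly_Mapping.keys p" Poly_Mapping.lookup])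
    show "(\<Sum>m\<in>Poly_Mapping.keys p. Poly_Mapping.lookup p m * (\<Prod>v\<in>?W. x v ^ Poly_Mapping.lookup m v)) = 0" for x
    proof -
      have "(\<Prod>v\<in>?W. x v ^ Poly_Mapping.lookup m v) = (\<Prod>v\<in>Poly_Mapping.keys m. x v ^ Poly_Mapping.lookup m v)"
        if "m \<in> Poly_Mapping.keys p" for m
        using that by (intro prod.mono_neutral_right) (auto simp: in_keys_iff)
      then show ?thesis
        using assms[of x] by (simp add: eval_mpoly_def)
    qed
    show "m = m'" if mm: "m \<in> Poly_Mapping.keys p" "m' \<in> Poly_Mapping.keys p"
      "\<And>v. v \<in> ?W \<Longrightarrow> Poly_Mapping.lookup m v = Poly_Mapping.lookup m' v" for m m'
    proof (rule poly_mapping_eqI)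
      fix v
      show "Poly_Mapping.lookup m v = Poly_Mapping.lookup m' v"
      proof (cases "v \<in> ?W")
        case False
        then show ?thesis using mm(1,2) by (auto simp: in_keys_iff)
      qed (rule mm(3))
    qed
  qed (use m in auto)
  then show ?thesis
    by (metis keys_eq_empty equals0I in_keys_iff)
qed

lemma total_degree_add:
  fixes m n :: "'v \<Rightarrow>\<^sub>0 nat"
  shows "(\<Sum>v\<in>Poly_Mapping.keys (m + n). Poly_Mapping.lookup (m + n) v) =
    (\<Sum>v\<in>Poly_Mapping.keys m. Poly_Mapping.lookup m v) + (\<Sum>v\<in>Poly_Mapping.keys n. Poly_Mapping.lookup n v)"
proof -
  let ?K = "Poly_Mapping.keys m \<union> Poly_Mapping.keys n"
  have *: "(\<Sum>v\<in>Poly_Mapping.keys k. Poly_Mapping.lookup k v) = (\<Sum>v\<in>?K. Poly_Mapping.lookup k v)"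
    if "Poly_Mapping.keys k \<subseteq> ?K" for k :: "'v \<Rightarrow>\<^sub>0 nat"
    using that by (intro sum.mono_neutral_left) (auto simp: in_keys_iff)
  show ?thesis
    unfolding *[OF Un_upper1] *[OF Un_upper2] *[OF Poly_Mapping.keys_add] sum.distrib[symmetric]
    by (rule sum.cong) (simp_all add: lookup_add)
qed

lemma homogeneous_add: "homogeneous d p \<Longrightarrow> homogeneous d q \<Longrightarrow> homogeneous d (p + q)"
  using Poly_Mapping.keys_add[of p q] unfolding homogeneous_def by blast

lemma homogeneous_mult:
  assumes "homogeneous d p" "homogeneous e q"
  shows "homogeneous (d + e) (p * q)"
  unfolding homogeneous_def
proof
  fix k assume "k \<in> Poly_Mapping.keys (p * q)"
  then obtain m n where "k = m + n" "m \<in> Poly_Mapping.keys p" "n \<in> Poly_Mapping.keys q"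
    using keys_mult[of p q] by blast
  then show "(\<Sum>v\<in>Poly_Mapping.keys k. Poly_Mapping.lookup k v) = d + e"
    using assms by (simp add: total_degree_add homogeneous_def)
qed

text \<open>
  The restriction of \<open>F\<close> to \<open>S\<close> is given by a homogeneous polynomial of degree \<open>d\<close> in the coordinates \<open>x\<close>. Working
  with functions allows one to obtain such polynomials by closure properties only, on the space of quadruples
  as well as on the group.
\<close>

definition is_form :: "('x \<Rightarrow> 'v \<Rightarrow> complex) \<Rightarrow> 'x set \<Rightarrow> nat \<Rightarrow> ('x \<Rightarrow> complex) \<Rightarrow> bool" where
  "is_form x S d F \<longleftrightarrow> (\<exists>p. homogeneous d p \<and> (\<forall>X\<in>S. eval_mpoly (x X) p = F X))"

lemma is_form_add: "is_form x S d F \<Longrightarrow> is_form x S d H \<Longrightarrow> is_form x S d (\<lambda>X. F X + H X)"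
  unfolding is_form_def by (metis homogeneous_add eval_mpoly_add)

lemma is_form_mult: "is_form x S d F \<Longrightarrow> is_form x S e H \<Longrightarrow> n = d + e \<Longrightarrow> is_form x S n (\<lambda>X. F X * H X)"
  unfolding is_form_def by (metis homogeneous_mult eval_mpoly_mult)

lemma is_form_const: "is_form x S 0 (\<lambda>X. c)"
  unfolding is_form_def
  by (rule exI[of _ "const_mpoly c"]) (auto simp: eval_const_mpoly homogeneous_def, auto simp: const_mpoly_def split: if_splits)

lemma is_form_uminus: "is_form x S d F \<Longrightarrow> is_form x S d (\<lambda>X. - F X)"
  using is_form_mult[OF is_form_const[of x S "- 1"], of d F d] by simp

lemma is_form_diff: "is_form x S d F \<Longrightarrow> is_form x S d H \<Longrightarrow> is_form x S d (\<lambda>X. F X - H X)"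
  using is_form_add[OF _ is_form_uminus, of x S d F H] by simp

lemma is_form_zero: "is_form x S d (\<lambda>X. 0)"
  unfolding is_form_def by (rule exI[of _ 0]) (simp add: homogeneous_def eval_mpoly_zero)

lemma is_form_sum: "(\<And>a. a \<in> A \<Longrightarrow> is_form x S d (F a)) \<Longrightarrow> is_form x S d (\<lambda>X. \<Sum>a\<in>A. F a X)"
  by (induction A rule: infinite_finite_induct) (simp_all add: is_form_zero is_form_add)

lemma is_form_power: "is_form x S d F \<Longrightarrow> e = d * n \<Longrightarrow> is_form x S e (\<lambda>X. F X ^ n)"
proof (induction n arbitrary: e)
  case 0
  then show ?case using is_form_const[of x S 1] by simp
next
  case (Suc n)
  then show ?case
    by (simp add: is_form_mult)
qed

lemma is_form_cong: "(\<And>X. X \<in> S \<Longrightarrow> F X = H X) \<Longrightarrow> is_form x S d F \<longleftrightarrow> is_form x S d H"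
  unfolding is_form_def by simp

lemma is_form_var:
  assumes "\<And>X. X \<in> S \<Longrightarrow> x X v = F X"
  shows "is_form x S 1 F"
  unfolding is_form_def
  by (rule exI[of _ "Poly_Mapping.single (Poly_Mapping.single v 1) 1"])
    (auto simp: homogeneous_def eval_mpoly_single assms)

lemma is_form_det_4:
  fixes M :: "'x \<Rightarrow> complex^4^4"
  assumes "\<And>i j. is_form x S d (\<lambda>X. M X $ i $ j)"
  shows "is_form x S (4 * d) (\<lambda>X. det (M X))"
proof -
  have "is_form x S (2 * d) (\<lambda>X. M X $ i $ j * M X $ k $ l)" for i j k l
    by (rule is_form_mult[OF assms assms]) simp
  then have "is_form x S (3 * d) (\<lambda>X. M X $ i $ j * M X $ k $ l * M X $ p $ q)" for i j k l p q
    by (rule is_form_mult[OF _ assms]) simp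
  then have "is_form x S (4 * d) (\<lambda>X. M X $ i $ j * M X $ k $ l * M X $ p $ q * M X $ r $ s)" for i j k l p q r s
    by (rule is_form_mult[OF _ assms]) simp
  then show ?thesis
    unfolding det_4 by (intro is_form_add is_form_diff)
qed

section \<open>Forms on the space of quadruples\<close>

definition upper_pairs :: "(5 \<times> 5) set" where
  "upper_pairs = {(1, 2), (1, 3), (1, 4), (1, 5), (2, 3), (2, 4), (2, 5), (3, 4), (3, 5), (4, 5)}"

lemma upper_trichotomy: "i = j \<or> (i, j) \<in> upper_pairs \<or> (j, i) \<in> upper_pairs"
  using exhaust_5[of i] exhaust_5[of j] by (elim disjE) (simp_all add: upper_pairs_def)

lemma upper_asym: "(i, j) \<in> upper_pairs \<Longrightarrow> (j, i) \<notin> upper_pairs"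
  using exhaust_5[of i] exhaust_5[of j] by (elim disjE) (simp_all add: upper_pairs_def)

lemma coords_Abs:
  assumes "(i, j) \<in> upper_pairs"
  shows "coords X (Abs_coord (k, i, j)) = X$k$i$j"
proof -
  have "(k, i, j) \<in> {(k::4, i::5, j::5). (i, j) \<in> upper_pairs}"
    using assms by simp
  then show ?thesis
    unfolding upper_pairs_def by (simp only: coords_def Abs_coord_inverse case_prod_conv)
qed

lemma is_form_entry: "is_form coords V 1 (\<lambda>X. X$k$i$j)"
proof -
  have up: "is_form coords V 1 (\<lambda>X. X$k$i$j)" if "(i, j) \<in> upper_pairs" for i j
    using that by (intro is_form_var[where v = "Abs_coord (k, i, j)"]) (simp add: coords_Abs)
  consider "(i, j) \<in> upper_pairs" | "i = j" | "(j, i) \<in> upper_pairs"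
    using upper_trichotomy by blast
  then show ?thesis
  proof cases
    case 1
    then show ?thesis by (rule up)
  next
    case 2
    have "is_form coords V 1 (\<lambda>X. X$k$i$j) \<longleftrightarrow> is_form coords V 1 (\<lambda>X. 0)"
      using 2 Alt5_nth(2)[OF V_nth] by (intro is_form_cong) auto
    then show ?thesis using is_form_zero by simp
  next
    case 3
    have "is_form coords V 1 (\<lambda>X. X$k$i$j) \<longleftrightarrow> is_form coords V 1 (\<lambda>X. - X$k$j$i)"
      by (intro is_form_cong Alt5_nth(1)[OF V_nth])
    then show ?thesis using is_form_uminus[OF up[OF 3]] by simp
  qed
qed

lemma is_form_beta: "is_form coords V 2 (\<lambda>X. beta (X$i) (X$j) $ n)"
proof -
  have m: "is_form coords V 2 (\<lambda>X. X$i$p$q * X$j$r$s)" for p q r s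
    by (rule is_form_mult[OF is_form_entry is_form_entry]) simp
  show ?thesis
    using exhaust_5[of n]
    by (elim disjE; simp only: beta_nth) (intro is_form_add is_form_diff is_form_uminus m)+
qed

lemma is_form_bracket: "is_form coords V 5 (\<lambda>X. bracket X i j k l m)"
  unfolding bracket_def scalar_product_def matrix_vector_mult_def vec_lambda_beta
  by (intro is_form_sum is_form_mult[OF is_form_beta is_form_sum[OF is_form_mult[OF is_form_entry is_form_beta refl]]]) simp

lemma is_form_Phi: "is_form coords V 10 (\<lambda>X. Phi X $ s $ t)"
proof -
  have c: "is_form coords V 10 (\<lambda>X. c * F X)" if "is_form coords V 10 F" for c F
    by (rule is_form_mult[OF is_form_const that]) simp
  have c5: "is_form coords V 5 (\<lambda>X. c * F X)" if "is_form coords V 5 F" for c F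
    by (rule is_form_mult[OF is_form_const that]) simp
  have m: "is_form coords V 10 (\<lambda>X. F X * H X)" if "is_form coords V 5 F" "is_form coords V 5 H" for F H
    by (rule is_form_mult[OF that]) simp
  have m3: "is_form coords V 10 (\<lambda>X. c * F X * H X)" if "is_form coords V 5 F" "is_form coords V 5 H" for c F H
    by (rule is_form_mult[OF c5[OF that(1)] that(2)]) simp
  have s: "is_form coords V 10 (\<lambda>X. F X ^ 2)" if "is_form coords V 5 F" for F
    by (rule is_form_power[OF that]) simp
  have "is_form coords V 10 (\<lambda>X. phi11 (perm_bracket \<sigma> (bracket X)))" for \<sigma>
    unfolding phi11_def perm_bracket_def
    by (intro is_form_add is_form_diff m3 m s c is_form_bracket c5)
  moreover have "is_form coords V 10 (\<lambda>X. phi12 (perm_bracket \<sigma> (bracket X)))" for \<sigma>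
    unfolding phi12_def perm_bracket_def
    by (intro is_form_add is_form_diff m3 m s c is_form_bracket c5)
  ultimately show ?thesis
    by (cases "s = t") (simp_all add: Phi_def)
qed

lemma coords_surj: "\<exists>X\<in>V. coords X = x"
proof -
  define X :: "complex^5^5^4" where
    "X = (\<chi> k i j. if (i, j) \<in> upper_pairs then x (Abs_coord (k, i, j)) else if (j, i) \<in> upper_pairs then - x (Abs_coord (k, j, i)) else 0)"
  have "X$k$j$i = - X$k$i$j" for k i j
  proof -
    consider "(i, j) \<in> upper_pairs" "(j, i) \<notin> upper_pairs" | "(i, j) \<notin> upper_pairs" "(j, i) \<in> upper_pairs" | "(i, j) \<notin> upper_pairs" "(j, i) \<notin> upper_pairs"
      using upper_asym by blast
    then show ?thesis
      by cases (simp_all only: X_def vec_lambda_beta if_True if_False not_False_eq_True minus_minus minus_zero)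
  qed
  then have "X \<in> V"
    unfolding V_def mem_Collect_eq Alt5_iff by blast
  moreover have "coords X v = x v" for v
  proof (cases v)
    case (Abs_coord y)
    obtain k i j where y: "y = (k, i, j)" by (cases y)
    then have up: "(i, j) \<in> upper_pairs" using Abs_coord by (simp add: upper_pairs_def)
    show ?thesis
      unfolding Abs_coord(1) y coords_Abs[OF up] by (simp only: X_def vec_lambda_beta up if_True)
  qed
  ultimately show ?thesis by blast
qed

lemma poly_at_vanish:
  assumes "\<And>X. X \<in> V \<Longrightarrow> poly_at P X = 0"
  shows "P = 0"
proof (rule mpoly_vanish)
  fix x
  obtain X where "X \<in> V" "coords X = x" using coords_surj by blast
  then show "eval_mpoly x P = 0" using assms[of X] by (simp add: poly_at_def)
qed

section \<open>Density of an orbit\<close>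

text \<open>
  A scalar \<open>a\<close> in the first factor acts as \<open>a\<^sup>2\<close> in the second, so a fifth root of \<open>det A\<close> can be moved across. Thus
  the orbits of \<open>SL\<^sub>5 \<times> GL\<^sub>4\<close> are those of \<open>GL\<^sub>5 \<times> GL\<^sub>4\<close>, which is open in a space of matrices.
\<close>

lemma orbit_GL:
  assumes "det A \<noteq> 0" "det B \<noteq> 0"
  shows "\<exists>g\<in>G. rho (A, B) X = rho g X"
proof -
  define a where "a = exp (Ln (det A) / 5)"
  have "a ^ 5 = det A"
    using assms(1) by (simp add: a_def flip: exp_of_nat_mult)
  have "a \<noteq> 0" by (simp add: a_def)
  let ?A = "mat (1 / a) ** A" and ?B = "mat (a ^ 2) ** B"
  have nth: "(mat c ** M) $ i $ j = c * M $ i $ j" for c and M :: "complex^'n^'n" and i j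
    by (simp add: matrix_matrix_mult_def mat_def if_distrib[of "\<lambda>x. x * _"] cong: if_cong)
  have "det ?A = 1"
    unfolding det_mul using \<open>a ^ 5 = det A\<close> \<open>a \<noteq> 0\<close> assms(1)
    by (subst det_diagonal) (auto simp: mat_def power_one_over)
  moreover have "det ?B \<noteq> 0"
    unfolding det_mul using \<open>a \<noteq> 0\<close> assms(2)
    by (subst det_diagonal) (auto simp: mat_def)
  moreover have "rho (?A, ?B) X = rho (A, B) X"
    unfolding vec_eq_iff rho_nth congruence_nth nth using \<open>a \<noteq> 0\<close>
    by (simp add: case_prod_unfold sum_distrib_left power2_eq_square field_simps)
  ultimately show ?thesis
    by (intro bexI[of _ "(?A, ?B)"]) (simp_all add: G_def invertible_det_nz)
qed

text \<open>
  The tangent map \<open>(a,b) \<mapsto> (a X\<^sub>k + X\<^sub>k a\<^sup>t + \<Sum>\<^sub>j b\<^sub>k\<^sub>j X\<^sub>j)\<^sub>k\<close> at the point with both parameters one maps a space of dimension \<open>41\<close>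
  onto one of dimension \<open>40\<close>; its kernel consists of the pairs of scalars \<open>(c,-2c)\<close>. The two matrices below solve the
  linear system for a given right-hand side, normalised by a zero in the last diagonal entry of \<open>a\<close>.
\<close>

definition tangent_lift_five :: "complex^5^5^4 \<Rightarrow> complex^5^5" where
  "tangent_lift_five Z = vector [
     vector [Z$4$1$4 / 2 - Z$4$3$5 / 2 + Z$2$2$3 / 3 - Z$2$4$5 / 3 - Z$3$2$5 / 3 + Z$3$1$3 / 3 - Z$1$3$4 / 6 + Z$1$1$5 / 6,
       2 * Z$2$1$3 / 3 - 2 * Z$2$2$5 / 3 + Z$4$1$2 - Z$1$4$5 / 3 + Z$1$2$3 / 3 - Z$3$3$4 / 3 + Z$3$1$5 / 3,
       - Z$2$1$2,
       Z$2$1$5 / 3 - Z$2$3$4 / 3 - Z$3$4$5 / 3 + Z$3$2$3 / 3 - Z$4$2$4 - 2 * Z$1$1$3 / 3 + 2 * Z$1$2$5 / 3,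
       - Z$3$1$2 + Z$1$2$4],
     vector [Z$4$2$4,
       Z$3$2$5 / 3 - Z$3$1$3 / 3 + Z$4$1$4 / 2 - Z$4$3$5 / 2 + Z$1$3$4 / 6 - Z$1$1$5 / 6 + 2 * Z$2$2$3 / 3 - 2 * Z$2$4$5 / 3,
       Z$1$2$4,
       Z$4$1$2,
       Z$1$1$2],
     vector [Z$4$3$4 / 2 + Z$1$3$5 / 2 - Z$1$1$4 / 2 - Z$2$1$2 - Z$4$1$5 / 2,
       Z$3$3$5 - Z$3$1$4 + 2 * Z$2$2$4 + 3 * Z$1$1$2 - Z$4$4$5 + Z$4$2$3,
       Z$2$2$3 / 3 - Z$2$4$5 / 3 - Z$3$2$5 / 3 + Z$1$3$4 / 3 - Z$1$1$5 / 3 + Z$3$1$3 / 3,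
       Z$4$1$3 - Z$3$1$2 + 2 * Z$1$2$4 - Z$4$2$5,
       Z$1$1$3 / 3 - Z$1$2$5 / 3 + Z$2$1$5 / 3 - Z$2$3$4 / 3 - Z$3$4$5 / 3 + Z$3$2$3 / 3],
     vector [- Z$3$3$4 / 3 + Z$3$1$5 / 3 - Z$2$1$3 / 3 + Z$2$2$5 / 3 - Z$4$1$2 + 2 * Z$1$4$5 / 3 - 2 * Z$1$2$3 / 3,
       2 * Z$3$4$5 / 3 - 2 * Z$3$2$3 / 3 + Z$4$2$4 + Z$1$1$3 / 3 - Z$1$2$5 / 3 + Z$2$1$5 / 3 - Z$2$3$4 / 3,
       Z$2$2$4 + Z$1$1$2,
       Z$1$3$4 / 2 - Z$1$1$5 / 2 + Z$4$1$4 / 2 - Z$4$3$5 / 2,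
       Z$3$2$4],
     vector [- Z$4$4$5 + Z$2$2$4 + 2 * Z$1$1$2 + Z$4$2$3,
       - Z$2$3$5 + Z$2$1$4 - 2 * Z$3$1$2 + 3 * Z$1$2$4 + Z$4$1$3 - Z$4$2$5,
       - Z$1$4$5 / 3 + Z$1$2$3 / 3 - Z$3$3$4 / 3 + Z$3$1$5 / 3 - Z$2$1$3 / 3 + Z$2$2$5 / 3,
       Z$4$1$5 / 2 + Z$1$3$5 / 2 - Z$1$1$4 / 2 + Z$3$2$4 - Z$4$3$4 / 2,
       0]]"

definition tangent_lift_four :: "complex^5^5^4 \<Rightarrow> complex^4^4" where
  "tangent_lift_four Z = vector [
     vector [5 * Z$1$1$5 / 6 - Z$4$1$4 / 2 + Z$4$3$5 / 2 - Z$2$2$3 / 3 + Z$2$4$5 / 3 + Z$3$2$5 / 3 - Z$3$1$3 / 3 + Z$1$3$4 / 6,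
       Z$1$2$3 + Z$4$1$2,
       Z$1$2$5 - Z$4$2$4,
       Z$1$1$4 + Z$2$1$2 - Z$3$2$4],
     vector [Z$2$3$4 / 3 + Z$3$4$5 / 3 - Z$3$2$3 / 3 + Z$4$2$4 + 2 * Z$1$1$3 / 3 - 2 * Z$1$2$5 / 3 + 2 * Z$2$1$5 / 3,
       Z$2$4$5 - Z$1$3$4 / 2 + Z$1$1$5 / 2 - Z$4$1$4 / 2 + Z$4$3$5 / 2,
       2 * Z$2$2$5 / 3 - Z$4$1$2 + Z$1$4$5 / 3 - Z$1$2$3 / 3 + Z$3$3$4 / 3 - Z$3$1$5 / 3 + Z$2$1$3 / 3,
       Z$2$1$4 - Z$3$1$2 + Z$1$2$4],
     vector [Z$3$1$5 / 3 - Z$2$1$3 / 3 + Z$2$2$5 / 3 - Z$4$1$2 + 2 * Z$1$4$5 / 3 - 2 * Z$1$2$3 / 3 + 2 * Z$3$3$4 / 3,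
       2 * Z$3$2$3 / 3 - Z$4$2$4 - Z$1$1$3 / 3 + Z$1$2$5 / 3 - Z$2$1$5 / 3 + Z$2$3$4 / 3 + Z$3$4$5 / 3,
       Z$3$1$3 / 3 - Z$4$1$4 / 2 + Z$4$3$5 / 2 - Z$1$3$4 / 6 + Z$1$1$5 / 6 - 2 * Z$2$2$3 / 3 + 2 * Z$2$4$5 / 3 + 2 * Z$3$2$5 / 3,
       Z$3$1$4 - Z$2$2$4 - Z$1$1$2],
     vector [- Z$1$3$5 / 2 + Z$1$1$4 / 2 + Z$2$1$2 - Z$3$2$4 + Z$4$1$5 / 2 + Z$4$3$4 / 2,
       Z$4$2$3 + Z$1$1$2,
       Z$4$2$5 - Z$1$2$4,
       Z$4$3$5 - Z$2$2$3 / 3 + Z$2$4$5 / 3 + Z$3$2$5 / 3 - Z$1$3$4 / 3 + Z$1$1$5 / 3 - Z$3$1$3 / 3]]"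

lemma lift_tangent:
  assumes "Z \<in> V"
  shows "(\<Sum>s\<in>UNIV. tangent_lift_five Z $ p $ s * sample 1 1 $ k $ s $ q) + (\<Sum>r\<in>UNIV. sample 1 1 $ k $ p $ r * tangent_lift_five Z $ q $ r)
     + (\<Sum>j\<in>UNIV. tangent_lift_four Z $ k $ j * sample 1 1 $ j $ p $ q) = Z $ k $ p $ q"
proof -
  have "\<forall>k p q. (\<Sum>s\<in>UNIV. tangent_lift_five Z $ p $ s * sample 1 1 $ k $ s $ q) + (\<Sum>r\<in>UNIV. sample 1 1 $ k $ p $ r * tangent_lift_five Z $ q $ r)
     + (\<Sum>j\<in>UNIV. tangent_lift_four Z $ k $ j * sample 1 1 $ j $ p $ q) = Z $ k $ p $ q"
    unfolding forall_4 forall_5 sum_4 sum_5 sample_nth tangent_lift_five_def tangent_lift_four_def vector_4 vector_5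
    by (simp add: wedge_nth map_matrix_def Alt5_lower[OF V_nth[OF assms]])
  then show ?thesis by blast
qed

lemma has_derivative_vecI:
  fixes f :: "'a::euclidean_space \<Rightarrow> 'b::real_normed_vector^'n"
  assumes "\<And>i. ((\<lambda>x. f x $ i) has_derivative (\<lambda>h. f' h $ i)) (at x)"
  shows "(f has_derivative f') (at x)"
proof -
  have lin: "linear (\<lambda>h. f' h $ i)" for i
    using has_derivative_bounded_linear[OF assms] by (simp add: bounded_linear.linear)
  have "linear f'"
    by (rule linearI) (simp_all add: vec_eq_iff linear_add[OF lin] linear_scale[OF lin])
  then have "bounded_linear f'"
    by (simp add: linear_conv_bounded_linear)
  moreover have "((\<lambda>y. (f y - f x - f' (y - x)) /\<^sub>R norm (y - x)) \<longlongrightarrow> 0) (at x)"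
    using assms by (intro vec_tendstoI) (simp add: has_derivative_at_within netlimit_at has_derivative_def)
  ultimately show ?thesis
    by (simp add: has_derivative_def netlimit_at)
qed

text \<open>
  The summand \<open>W\<^sub>k + W\<^sub>k\<^sup>t\<close> fills the complement of the skew-symmetric matrices. In this way the open mapping
  theorem applies to the ambient Euclidean space, and skew-symmetry of a value forces the summand to vanish.
\<close>

definition orbit_map :: "complex^5^5^4 \<Rightarrow> (complex^5^5) \<times> (complex^4^4) \<times> (complex^5^5^4) \<Rightarrow> complex^5^5^4" where
  "orbit_map X = (\<lambda>(A, B, W). rho (A, B) X + (\<chi> k p q. W$k$p$q + W$k$q$p))"

lemma orbit_map_nth:
  "orbit_map X z $ k $ p $ q = (\<Sum>j\<in>UNIV. fst (snd z) $ k $ j * (\<Sum>r\<in>UNIV. \<Sum>s\<in>UNIV. fst z $ p $ s * X$j$s$r * fst z $ q $ r))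
     + (snd (snd z) $ k $ p $ q + snd (snd z) $ k $ q $ p)"
  by (simp add: orbit_map_def case_prod_unfold rho_nth congruence_nth sum.cartesian_product)

lemma orbit_map_has_derivative:
  "(orbit_map X has_derivative (\<lambda>h. \<chi> k p q.
      (\<Sum>s\<in>UNIV. fst h $ p $ s * X $ k $ s $ q) + (\<Sum>r\<in>UNIV. X $ k $ p $ r * fst h $ q $ r)
      + (\<Sum>j\<in>UNIV. fst (snd h) $ k $ j * X $ j $ p $ q)
      + (snd (snd h) $ k $ p $ q + snd (snd h) $ k $ q $ p))) (at (mat 1, mat 1, 0))"
proof (intro has_derivative_vecI)
  fix k p q
  let ?z = "(mat 1, mat 1, 0) :: (complex^5^5) \<times> (complex^4^4) \<times> (complex^5^5^4)"
  have A: "((\<lambda>z. fst z $ i $ j) has_derivative (\<lambda>h. fst h $ i $ j)) (at ?z)" for i j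
    by (intro bounded_linear_imp_has_derivative bounded_linear_compose[OF bounded_linear_vec_nth] bounded_linear_fst)
  have B: "((\<lambda>z. fst (snd z) $ i $ j) has_derivative (\<lambda>h. fst (snd h) $ i $ j)) (at ?z)" for i j
    by (intro bounded_linear_imp_has_derivative bounded_linear_compose[OF bounded_linear_vec_nth]
        bounded_linear_compose[OF bounded_linear_fst bounded_linear_snd])
  have W: "((\<lambda>z. snd (snd z) $ i $ j $ l) has_derivative (\<lambda>h. snd (snd h) $ i $ j $ l)) (at ?z)" for i j l
    by (intro bounded_linear_imp_has_derivative bounded_linear_compose[OF bounded_linear_vec_nth]
        bounded_linear_compose[OF bounded_linear_snd bounded_linear_snd])
  have delta: "(\<Sum>s\<in>UNIV. mat 1 $ i $ s * f s) = f i" "(\<Sum>s\<in>UNIV. f s * mat 1 $ i $ s) = f i"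
    for i :: "'n::finite" and f :: "'n \<Rightarrow> complex"
    by (simp_all add: mat_def if_distrib[of "\<lambda>x. x * _"] if_distrib[of "\<lambda>x. _ * x"] cong: if_cong)
  have conj: "((\<lambda>z. \<Sum>r\<in>UNIV. \<Sum>s\<in>UNIV. fst z $ p $ s * X$j$s$r * fst z $ q $ r) has_derivative
      (\<lambda>h. (\<Sum>s\<in>UNIV. fst h $ p $ s * X $ j $ s $ q) + (\<Sum>r\<in>UNIV. X $ j $ p $ r * fst h $ q $ r))) (at ?z)" for j
  proof -
    have "((\<lambda>z. \<Sum>r\<in>UNIV. \<Sum>s\<in>UNIV. fst z $ p $ s * X$j$s$r * fst z $ q $ r) has_derivative
      (\<lambda>h. \<Sum>r\<in>UNIV. \<Sum>s\<in>UNIV. fst ?z $ p $ s * X$j$s$r * fst h $ q $ r + fst h $ p $ s * X$j$s$r * fst ?z $ q $ r)) (at ?z)"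
      by (intro has_derivative_sum has_derivative_mult has_derivative_mult_left A)
    moreover have "(\<Sum>r\<in>UNIV. \<Sum>s\<in>UNIV. fst ?z $ p $ s * X$j$s$r * fst h $ q $ r + fst h $ p $ s * X$j$s$r * fst ?z $ q $ r)
        = (\<Sum>s\<in>UNIV. fst h $ p $ s * X $ j $ s $ q) + (\<Sum>r\<in>UNIV. X $ j $ p $ r * fst h $ q $ r)"
      for h :: "(complex^5^5) \<times> (complex^4^4) \<times> (complex^5^5^4)"
      by (simp add: sum.distrib delta mult.assoc flip: sum_distrib_left sum_distrib_right)
        (subst sum.swap, simp add: delta flip: sum_distrib_left)
    ultimately show ?thesis by (simp only:)
  qed
  have z: "(\<Sum>r\<in>UNIV. \<Sum>s\<in>UNIV. fst ?z $ p $ s * X$j$s$r * fst ?z $ q $ r) = X$j$p$q" for j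
    by (simp add: delta mult.assoc)
  have "((\<lambda>z. orbit_map X z $ k $ p $ q) has_derivative (\<lambda>h.
      (\<Sum>j\<in>UNIV. fst (snd ?z) $ k $ j * ((\<Sum>s\<in>UNIV. fst h $ p $ s * X $ j $ s $ q) + (\<Sum>r\<in>UNIV. X $ j $ p $ r * fst h $ q $ r))
          + fst (snd h) $ k $ j * (\<Sum>r\<in>UNIV. \<Sum>s\<in>UNIV. fst ?z $ p $ s * X$j$s$r * fst ?z $ q $ r))
      + (snd (snd h) $ k $ p $ q + snd (snd h) $ k $ q $ p))) (at ?z)"
    unfolding orbit_map_nth
    by (intro has_derivative_add has_derivative_sum has_derivative_mult conj B W)
  then show "((\<lambda>z. orbit_map X z $ k $ p $ q) has_derivative (\<lambda>h. (\<chi> k p q.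
      (\<Sum>s\<in>UNIV. fst h $ p $ s * X $ k $ s $ q) + (\<Sum>r\<in>UNIV. X $ k $ p $ r * fst h $ q $ r)
      + (\<Sum>j\<in>UNIV. fst (snd h) $ k $ j * X $ j $ p $ q)
      + (snd (snd h) $ k $ p $ q + snd (snd h) $ k $ q $ p)) $ k $ p $ q)) (at ?z)"
    unfolding z by (simp add: sum.distrib delta)
qed

lemma orbit_map_continuous: "continuous_on UNIV (orbit_map X)"
proof -
  have "orbit_map X = (\<lambda>z. \<chi> k p q. (\<Sum>j\<in>UNIV. fst (snd z) $ k $ j * (\<Sum>r\<in>UNIV. \<Sum>s\<in>UNIV. fst z $ p $ s * X$j$s$r * fst z $ q $ r))
     + (snd (snd z) $ k $ p $ q + snd (snd z) $ k $ q $ p))"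
    by (intro ext) (simp add: vec_eq_iff orbit_map_nth)
  then show ?thesis
    by (simp only:) (intro continuous_intros continuous_on_vec_lambda)
qed

lemma open_det_nonzero: "open {A :: complex^'n^'n. det A \<noteq> 0}"
proof -
  have "continuous_on UNIV (\<lambda>A :: complex^'n^'n. det A)"
    unfolding det_def by (intro continuous_intros)
  then show ?thesis
    by (intro open_Collect_neq) (auto intro: continuous_intros)
qed

lemma orbit_contains_neighbourhood:
  "\<exists>e>0. \<forall>Y\<in>V. dist (sample 1 1) Y < e \<longrightarrow> (\<exists>g\<in>G. Y = rho g (sample 1 1))"
proof -
  let ?X = "sample 1 1"
  let ?z = "(mat 1, mat 1, 0) :: (complex^5^5) \<times> (complex^4^4) \<times> (complex^5^5^4)"
  define T :: "((complex^5^5) \<times> (complex^4^4) \<times> (complex^5^5^4)) set" where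
    "T = {A. det A \<noteq> 0} \<times> {B. det B \<noteq> 0} \<times> UNIV"
  define alt :: "complex^5^5^4 \<Rightarrow> complex^5^5^4" where "alt Y = (\<chi> k p q. (Y$k$p$q - Y$k$q$p) / 2)" for Y
  define g' where "g' Y = (tangent_lift_five (alt Y), tangent_lift_four (alt Y), (\<chi> k p q. (Y$k$p$q + Y$k$q$p) / 4))" for Y :: "complex^5^5^4"
  let ?F' = "\<lambda>h. \<chi> k p q.
      (\<Sum>s\<in>UNIV. fst h $ p $ s * ?X $ k $ s $ q) + (\<Sum>r\<in>UNIV. ?X $ k $ p $ r * fst h $ q $ r)
      + (\<Sum>j\<in>UNIV. fst (snd h) $ k $ j * ?X $ j $ p $ q)
      + (snd (snd h) $ k $ p $ q + snd (snd h) $ k $ q $ p)"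
  have alt: "alt Y \<in> V" for Y
    unfolding V_def mem_Collect_eq Alt5_iff by (simp add: alt_def field_simps)
  have right_inverse: "?F' (g' Y) = Y" for Y
    unfolding vec_eq_iff vec_lambda_beta g'_def fst_conv snd_conv lift_tangent[OF alt]
    by (simp add: alt_def field_simps)
  have "linear (\<lambda>Y. tangent_lift_five (alt Y))"
    by (rule linearI; simp only: vec_eq_iff forall_5 tangent_lift_five_def vector_5 alt_def vec_lambda_beta vector_add_component vector_scaleR_component)
      (simp_all add: field_simps scaleR_conv_of_real)
  moreover have "linear (\<lambda>Y. tangent_lift_four (alt Y))"
    by (rule linearI; simp only: vec_eq_iff forall_4 tangent_lift_four_def vector_4 alt_def vec_lambda_beta vector_add_component vector_scaleR_component)
      (simp_all add: field_simps scaleR_conv_of_real)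
  moreover have "linear (\<lambda>Y :: complex^5^5^4. \<chi> k p q. (Y$k$p$q + Y$k$q$p) / 4)"
    by (rule linearI; simp only: vec_eq_iff vec_lambda_beta vector_add_component vector_scaleR_component)
      (simp_all add: field_simps scaleR_conv_of_real)
  ultimately have lin: "bounded_linear g'"
    unfolding g'_def by (intro bounded_linear_Pair) (simp_all add: linear_conv_bounded_linear)
  have "open T"
    unfolding T_def by (intro open_Times open_det_nonzero open_UNIV)
  then have "?z \<in> interior T"
    by (simp add: interior_open T_def)
  have "orbit_map ?X ?z \<in> interior (orbit_map ?X ` T)"
    by (rule sussmann_open_mapping[OF open_UNIV orbit_map_continuous UNIV_I orbit_map_has_derivative lin _ subset_UNIV \<open>?z \<in> interior T\<close>])
      (use right_inverse in \<open>simp add: fun_eq_iff\<close>)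
  moreover have "orbit_map ?X ?z = ?X"
    by (simp add: vec_eq_iff orbit_map_def rho_of_one transpose_mat)
  ultimately obtain e where e: "e > 0" "ball ?X e \<subseteq> orbit_map ?X ` T"
    by (auto simp: mem_interior)
  have "\<exists>g\<in>G. Y = rho g ?X" if "Y \<in> V" "dist ?X Y < e" for Y
  proof -
    have "Y \<in> orbit_map ?X ` T"
      using e that by auto
    then obtain A B W where T: "det A \<noteq> 0" "det B \<noteq> 0" and Y: "Y = orbit_map ?X (A, B, W)"
      by (auto simp: T_def)
    have Y_nth: "Y$k$p$q = rho (A, B) ?X $k$p$q + (W$k$p$q + W$k$q$p)" for k p q
      by (simp add: Y orbit_map_def)
    have "W$k$p$q + W$k$q$p = 0" for k p q
    proof -
      have "Y$k$q$p = - Y$k$p$q" "rho (A, B) ?X $k$q$p = - rho (A, B) ?X $k$p$q"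
        using Alt5_nth(1)[OF V_nth] that(1) rho_in_V[OF sample_in_V] by blast+
      then have "2 * (W$k$p$q + W$k$q$p) = 0"
        using Y_nth[of k p q] Y_nth[of k q p] by (simp add: algebra_simps)
      then show ?thesis
        by (metis mult_eq_0_iff zero_neq_numeral)
    qed
    then have "Y = rho (A, B) ?X"
      by (simp add: vec_eq_iff Y_nth)
    then show ?thesis
      using orbit_GL[OF T] by metis
  qed
  then show ?thesis using e(1) by blast
qed

text \<open>
  A polynomial that vanishes near \<open>X\<^sub>0\<close> vanishes on every line through \<open>X\<^sub>0\<close>, hence everywhere.
\<close>

lemma orbit_zariski_dense: "zariski_dense ((\<lambda>g. rho g (sample 1 1)) ` G)"
  unfolding zariski_dense_def
proof (intro allI impI)
  let ?X = "sample 1 1"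
  fix P assume P: "\<forall>X\<in>(\<lambda>g. rho g ?X) ` G. poly_at P X = 0"
  obtain e where e: "e > 0" "\<And>Y. Y \<in> V \<Longrightarrow> dist ?X Y < e \<Longrightarrow> \<exists>g\<in>G. Y = rho g ?X"
    using orbit_contains_neighbourhood by blast
  have near: "poly_at P Y = 0" if "Y \<in> V" "dist ?X Y < e" for Y
    using e(2)[OF that] P by auto
  show "P = 0"
  proof (rule poly_at_vanish)
    fix Y assume Y: "Y \<in> V"
    define L where "L s = ?X + s *\<^sub>R (Y - ?X)" for s :: real
    have L_nth: "L s $ k $ p $ q = ?X$k$p$q + of_real s * (Y$k$p$q - ?X$k$p$q)" for s k p q
      unfolding L_def vector_add_component vector_scaleR_component vector_minus_component
      by (simp add: scaleR_conv_of_real)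
    have L_V: "L s \<in> V" for s
      unfolding V_def mem_Collect_eq Alt5_iff
    proof (intro allI)
      fix k p q
      have "Y$k$q$p = - Y$k$p$q" "?X$k$q$p = - ?X$k$p$q"
        using Alt5_nth(1)[OF V_nth] Y sample_in_V by blast+
      then show "L s $ k $ q $ p = - L s $ k $ p $ q"
        by (simp add: L_nth algebra_simps)
    qed
    obtain q where q: "\<And>t. eval_mpoly (\<lambda>v. poly [:coords ?X v, coords Y v - coords ?X v:] t) P = poly q t"
      using eval_mpoly_curve[of "\<lambda>v. [:coords ?X v, coords Y v - coords ?X v:]" P] by blast
    have Lq: "poly_at P (L s) = poly q (of_real s)" for s
    proof -
      have "coords (L s) v = poly [:coords ?X v, coords Y v - coords ?X v:] (of_real s)" for v
        by (simp add: coords_def L_nth split: prod.split)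
      then show ?thesis
        unfolding poly_at_def q[symmetric] by metis
    qed
    \<comment> \<open>For smaller parameters the line stays inside the neighbourhood.\<close>
    define \<delta> where "\<delta> = e / (norm (Y - ?X) + 1)"
    have "\<delta> > 0" using e(1) by (simp add: \<delta>_def add_nonneg_pos)
    have "poly q (of_real s) = 0" if "0 < s" "s < \<delta>" for s
    proof -
      have "dist ?X (L s) = s * norm (Y - ?X)"
        using that by (simp add: L_def dist_norm)
      also have "\<dots> \<le> s * (norm (Y - ?X) + 1)" using that by simp
      also have "\<dots> < \<delta> * (norm (Y - ?X) + 1)"
        using that by (intro mult_strict_right_mono) (auto simp: add_nonneg_pos)
      also have "\<dots> = e"
        unfolding \<delta>_def by (simp add: add_nonneg_eq_0_iff)
      finally show ?thesis using near[OF L_V] Lq by metis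
    qed
    then have "complex_of_real ` {0<..<\<delta>} \<subseteq> {t. poly q t = 0}" by auto
    moreover have "infinite (complex_of_real ` {0<..<\<delta>})"
      using \<open>\<delta> > 0\<close> by (simp add: finite_image_iff inj_on_def infinite_Ioo)
    ultimately have "q = 0"
      using poly_roots_finite finite_subset by blast
    then have "poly_at P (L 1) = 0" by (simp add: Lq)
    then show "poly_at P Y = 0" by (simp add: L_def)
  qed
qed

lemma prehomogeneous_V: prehomogeneous
  unfolding prehomogeneous_def using orbit_zariski_dense sample_in_V by blast

section \<open>Irreducibility and uniqueness\<close>

lemma poly_at_curve:
  assumes "\<And>k p q. \<exists>c. \<forall>t. Y t $ k $ p $ q = poly c t"
  shows "\<exists>q. \<forall>t. poly_at P (Y t) = poly q t"
proof -
  have "\<exists>c. \<forall>t. coords (Y t) v = poly c t" for v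
    using assms by (cases "Rep_coord v") (simp add: coords_def)
  then obtain c where "\<And>t v. coords (Y t) v = poly (c v) t"
    by metis
  then have "poly_at P (Y t) = eval_mpoly (\<lambda>v. poly (c v) t) P" for t
    unfolding poly_at_def by presburger
  then show ?thesis
    using eval_mpoly_curve[of c P] by simp
qed

lemma G_det: "(A, B) \<in> G \<Longrightarrow> det A = 1" "(A, B) \<in> G \<Longrightarrow> det B \<noteq> 0" "(A, B) \<in> G \<Longrightarrow> invertible B"
  by (simp_all add: G_def invertible_det_nz)

text \<open>
  In each of the two variables the value along the orbit is a polynomial without zeros on a general linear
  group. The exponent belonging to \<open>A\<close> may depend on \<open>B\<close>, but on the group \<open>det A = 1\<close> and that power is one.
\<close>

lemma character_of_nonvanishing:
  assumes nz: "\<And>g. g \<in> G \<Longrightarrow> poly_at p (rho g X) \<noteq> 0"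
  shows "\<exists>k. \<forall>(A, B)\<in>G. poly_at p (rho (A, B) X) = poly_at p X * det B ^ k"
proof -
  have nz': "poly_at p (rho (A, B) X) \<noteq> 0" if "det A \<noteq> 0" "det B \<noteq> 0" for A B
    using orbit_GL[OF that, of X] nz by auto
  have A: "poly_at p (rho (A, B) X) = poly_at p (rho (mat 1, B) X)" if "det A = 1" "det B \<noteq> 0" for A B
  proof -
    have "\<exists>n. \<forall>A. det A \<noteq> 0 \<longrightarrow> poly_at p (rho (A, B) X) = poly_at p (rho (mat 1, B) X) * det A ^ n"
    proof (rule nonvanishing_polynomial_on_GL)
      fix M N :: "complex^5^5"
      show "\<exists>q. \<forall>t. poly_at p (rho (\<chi> i j. M$i$j + t * N$i$j, B) X) = poly q t"
      proof (rule poly_at_curve)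
        fix k r s
        show "\<exists>c. \<forall>t. rho (\<chi> i j. M$i$j + t * N$i$j, B) X $ k $ r $ s = poly c t"
          unfolding rho_nth congruence_nth
          by (rule exI[of _ "\<Sum>j\<in>UNIV. [:B$k$j:] * (\<Sum>(a, b)\<in>UNIV. [:M$r$b, N$r$b:] * [:X$j$b$a:] * [:M$s$a, N$s$a:])"])
            (simp add: poly_sum case_prod_unfold algebra_simps)
      qed
    qed (use nz' that in blast)
    then obtain n where "\<And>A. det A \<noteq> 0 \<Longrightarrow> poly_at p (rho (A, B) X) = poly_at p (rho (mat 1, B) X) * det A ^ n"
      by blast
    from this[of A] show ?thesis using that by simp
  qed
  have "\<exists>k. \<forall>B. det B \<noteq> 0 \<longrightarrow> poly_at p (rho (mat 1, B) X) = poly_at p (rho (mat 1, mat 1) X) * det B ^ k"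
  proof (rule nonvanishing_polynomial_on_GL)
    fix M N :: "complex^4^4"
    show "\<exists>q. \<forall>t. poly_at p (rho (mat 1, \<chi> i j. M$i$j + t * N$i$j) X) = poly q t"
    proof (rule poly_at_curve)
      fix k r s
      show "\<exists>c. \<forall>t. rho (mat 1, \<chi> i j. M$i$j + t * N$i$j) X $ k $ r $ s = poly c t"
        unfolding rho_one lin_comb_nth
        by (rule exI[of _ "\<Sum>j\<in>UNIV. [:M$k$j, N$k$j:] * [:X$j$r$s:]"]) (simp add: poly_sum algebra_simps)
    qed
  qed (use nz' in simp)
  then obtain k where k: "\<And>B. det B \<noteq> 0 \<Longrightarrow> poly_at p (rho (mat 1, B) X) = poly_at p (rho (mat 1, mat 1) X) * det B ^ k"
    by blast
  have "rho (mat 1, mat 1) X = X"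
    by (simp add: vec_eq_iff rho_of_one transpose_mat)
  then have "poly_at p (rho (A, B) X) = poly_at p X * det B ^ k" if "(A, B) \<in> G" for A B
    using A[of A B] k[of B] G_det[OF that] by simp
  then show ?thesis by blast
qed

lemma mpoly_eq_on_orbit:
  assumes "\<And>g. g \<in> G \<Longrightarrow> poly_at p (rho g (sample 1 1)) = poly_at q (rho g (sample 1 1))"
  shows "p = q"
proof -
  have "poly_at (p + const_mpoly (- 1) * q) (rho g (sample 1 1)) = 0" if "g \<in> G" for g
    using assms[OF that] by (simp add: poly_at_def eval_mpoly_add eval_mpoly_mult eval_const_mpoly)
  then have *: "p + const_mpoly (- 1) * q = 0"
    using orbit_zariski_dense unfolding zariski_dense_def by blast
  have "const_mpoly (- 1) + (1 :: coord mpoly) = 0"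
    unfolding const_mpoly_def single_one[symmetric] single_add[symmetric] by simp
  then have "const_mpoly (- 1) = (- 1 :: coord mpoly)"
    by (simp add: eq_neg_iff_add_eq_0)
  with * show ?thesis by simp
qed

lemma const_mpoly_unit: "c \<noteq> 0 \<Longrightarrow> const_mpoly c dvd 1"
  by (rule dvdI[of _ _ "const_mpoly (1 / c)"]) (simp add: const_mpoly_def mult_single)

text \<open>
  Two polynomials on a dense orbit with the same character agree up to a constant. Hence \<open>p^10\<close> is
  proportional to \<open>f\<^sup>k\<close>, and comparing degrees along a curve on which \<open>f\<close> is linear shows that \<open>k\<close> is a
  multiple of ten; then \<open>p\<close> itself is proportional to a power of \<open>f\<close>.
\<close>

lemma nonvanishing_is_power:
  assumes f: "\<And>X. X \<in> V \<Longrightarrow> poly_at f X = det (Phi X)"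
    and nz: "\<And>g. g \<in> G \<Longrightarrow> poly_at p (rho g (sample 1 1)) \<noteq> 0"
  shows "\<exists>c m. c \<noteq> 0 \<and> p = const_mpoly c * f ^ m"
proof -
  let ?X = "sample 1 1"
  let ?p = "poly_at p ?X" and ?f = "det (Phi ?X)"
  obtain k where k: "\<And>A B. (A, B) \<in> G \<Longrightarrow> poly_at p (rho (A, B) ?X) = ?p * det B ^ k"
    using character_of_nonvanishing[OF nz] by (auto split: prod.splits)
  have fk: "poly_at f (rho (A, B) ?X) = ?f * det B ^ 10" if "(A, B) \<in> G" for A B
    using that by (simp add: f rho_in_V sample_in_V det_Phi_rho G_det mult.commute)
  have "?f \<noteq> 0"
    by (simp add: det_Phi_sample)
  have one: "(mat 1, mat 1) \<in> G" "rho (mat 1, mat 1) ?X = ?X"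
    by (simp_all add: G_def invertible_det_nz vec_eq_iff rho_of_one transpose_mat)
  then have "?p \<noteq> 0"
    using nz by metis
  have eq: "const_mpoly (?f ^ k) * p ^ 10 = const_mpoly (?p ^ 10) * f ^ k"
  proof (rule mpoly_eq_on_orbit)
    fix g assume "g \<in> G"
    then show "poly_at (const_mpoly (?f ^ k) * p ^ 10) (rho g ?X) = poly_at (const_mpoly (?p ^ 10) * f ^ k) (rho g ?X)"
      using k fk
      by (cases g) (simp add: poly_at_def eval_mpoly_mult eval_const_mpoly eval_mpoly_power power_mult_distrib
          flip: power_mult, simp add: mult.commute)
  qed
  \<comment> \<open>The curve along which \<open>f\<close> is linear.\<close>
  have "\<exists>q. \<forall>t. poly_at p (sample 1 t) = poly q t"
  proof (rule poly_at_curve)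
    fix k r s
    have line: "sample 1 t $ k $ r $ s = sample 1 0 $ k $ r $ s + t * (if k = 4 then wedge 3 5 $ r $ s else 0)" for t
      using exhaust_4[of k] by (auto simp: sample_nth map_matrix_def)
    show "\<exists>c. \<forall>t. sample 1 t $ k $ r $ s = poly c t"
    proof (intro exI allI)
      fix t
      show "sample 1 t $ k $ r $ s = poly [:sample 1 0 $ k $ r $ s, if k = 4 then wedge 3 5 $ r $ s else 0:] t"
        unfolding line[of t] by simp
    qed
  qed
  then obtain q where q: "\<And>t. poly_at p (sample 1 t) = poly q t" by blast
  have "poly (smult (?f ^ k) (q ^ 10)) t = poly (smult (?p ^ 10) ([:0, - 71663616000:] ^ k)) t" for t
  proof -
    have "poly_at (const_mpoly (?f ^ k) * p ^ 10) (sample 1 t) = poly_at (const_mpoly (?p ^ 10) * f ^ k) (sample 1 t)"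
      by (simp only: eq)
    moreover have "poly_at f (sample 1 t) = t * - 71663616000"
      by (simp add: f sample_in_V det_Phi_sample)
    ultimately show ?thesis
      by (simp add: poly_at_def[symmetric] q eval_mpoly_mult eval_const_mpoly eval_mpoly_power poly_power
          flip: q) (simp add: poly_at_def eval_mpoly_mult eval_const_mpoly eval_mpoly_power)
  qed
  then have "smult (?f ^ k) (q ^ 10) = smult (?p ^ 10) ([:0, - 71663616000:] ^ k)"
    by (metis poly_eq_poly_eq_iff ext)
  then have "degree (smult (?f ^ k) (q ^ 10)) = degree (smult (?p ^ 10) ([:0, - 71663616000:] ^ k))"
    by simp
  moreover have "q \<noteq> 0"
    using q[of 1] \<open>?p \<noteq> 0\<close> by auto
  ultimately have "k = 10 * degree q"
    using \<open>?f \<noteq> 0\<close> \<open>?p \<noteq> 0\<close> by (simp add: degree_power_eq degree_linear_power)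
  define m where "m = degree q"
  have "p = const_mpoly (?p / ?f ^ m) * f ^ m"
  proof (rule mpoly_eq_on_orbit)
    fix g assume "g \<in> G"
    then show "poly_at p (rho g ?X) = poly_at (const_mpoly (?p / ?f ^ m) * f ^ m) (rho g ?X)"
      using k fk \<open>?f \<noteq> 0\<close> \<open>k = 10 * degree q\<close>
      by (cases g) (simp add: m_def poly_at_def eval_mpoly_mult eval_const_mpoly eval_mpoly_power power_mult_distrib power_mult)
  qed
  then show ?thesis
    using \<open>?f \<noteq> 0\<close> \<open>?p \<noteq> 0\<close> by (metis divide_eq_0_iff power_not_zero)
qed

lemma det_Phi_not_unit:
  assumes f: "\<And>X. X \<in> V \<Longrightarrow> poly_at f X = det (Phi X)"
  shows "\<not> f dvd 1"
proof
  assume "f dvd 1"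
  then obtain u where "1 = f * u" by (elim dvdE)
  then have "poly_at 1 0 = poly_at f 0 * poly_at u 0"
    unfolding poly_at_def eval_mpoly_mult[symmetric] by (rule arg_cong)
  moreover have "(0 :: complex^5^5^4) \<in> V"
    by (simp add: V_def Alt5_iff)
  then have "poly_at f 0 = 0"
    by (simp add: f Phi_zero det_4)
  ultimately show False
    by (simp add: poly_at_def eval_mpoly_one)
qed

text \<open>
  Two factors of \<open>f\<close> have no zeros on the orbit, so both are powers of \<open>f\<close> up to constants. As \<open>f\<close> is not
  constant, the exponents add up to one.
\<close>

lemma det_Phi_irreducible:
  assumes f: "\<And>X. X \<in> V \<Longrightarrow> poly_at f X = det (Phi X)"
  shows "irreducible f"
proof (rule irreducibleI)
  have f_sample: "poly_at f (sample 1 t) = - 71663616000 * t" for t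
    by (simp add: f sample_in_V det_Phi_sample)
  show "f \<noteq> 0"
    using f_sample[of 1] by (auto simp: poly_at_def eval_mpoly_zero)
  show "\<not> f dvd 1" by (rule det_Phi_not_unit[OF f])
  fix a b assume ab: "f = a * b"
  have "poly_at f (rho g (sample 1 1)) \<noteq> 0" if "g \<in> G" for g
    using that by (cases g) (simp add: f rho_in_V sample_in_V det_Phi_rho G_det det_Phi_sample)
  then have "poly_at a (rho g (sample 1 1)) \<noteq> 0" "poly_at b (rho g (sample 1 1)) \<noteq> 0" if "g \<in> G" for g
    using that by (auto simp: ab poly_at_def eval_mpoly_mult)
  then obtain c d m n where c: "c \<noteq> 0" "a = const_mpoly c * f ^ m" and d: "d \<noteq> 0" "b = const_mpoly d * f ^ n"
    using nonvanishing_is_power[OF f] by metis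
  have "poly_at f X = c * d * poly_at f X ^ (m + n)" for X
  proof -
    have "poly_at f X = poly_at a X * poly_at b X"
      by (subst ab) (simp add: poly_at_def eval_mpoly_mult)
    also have "\<dots> = c * d * poly_at f X ^ (m + n)"
      by (simp add: c(2) d(2) poly_at_def eval_mpoly_mult eval_const_mpoly eval_mpoly_power power_add)
    finally show ?thesis .
  qed
  then have eq: "- 71663616000 * t = c * d * (- 71663616000 * t) ^ (m + n)" for t
    by (metis f_sample)
  define a0 :: complex where "a0 = - 71663616000"
  have "a0 \<noteq> 0" by (simp add: a0_def)
  from eq have "a0 = c * d * a0 ^ (m + n)" "a0 * 2 = c * d * (a0 * 2) ^ (m + n)"
    unfolding a0_def by (metis mult_1_right, blast)
  then have "a0 * 2 = a0 * 2 ^ (m + n)"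
    by (metis mult.assoc power_mult_distrib)
  then have "(2 :: complex) ^ (m + n) = 2 ^ 1"
    using \<open>a0 \<noteq> 0\<close> by simp
  then have "of_nat (2 ^ (m + n)) = (of_nat (2 ^ 1) :: complex)"
    by simp
  then have "(2 :: nat) ^ (m + n) = 2 ^ 1"
    by (simp only: of_nat_eq_iff)
  then have "m + n = 1"
    by (subst (asm) power_inject_exp) simp_all
  then have "m = 0 \<or> n = 0" by auto
  then show "a dvd 1 \<or> b dvd 1"
    using c d by (auto simp: const_mpoly_unit)
qed

lemma det_Phi_relative_invariant:
  assumes f: "\<And>X. X \<in> V \<Longrightarrow> poly_at f X = det (Phi X)"
  shows "relative_invariant f (\<lambda>(A, B). det B ^ 10)"
  unfolding relative_invariant_def
proof (intro conjI ballI)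
  show "f \<noteq> 0"
    using det_Phi_irreducible[OF f] by auto
  have "is_form entries UNIV 1 (\<lambda>g. snd g $ i $ j)" for i j
    by (rule is_form_var[of _ _ "Inr (i, j)"]) (auto simp: entries_def)
  from is_form_power[OF is_form_det_4[OF this] refl, of 10]
  have "is_form entries UNIV 40 (\<lambda>g. det (snd g) ^ 10)" by simp
  then obtain P where "\<And>g. eval_mpoly (entries g) P = det (snd g) ^ 10"
    unfolding is_form_def by blast
  then have "regular_on_G (\<lambda>(A, B). det B ^ 10)"
    unfolding regular_on_G_def by (intro exI[of _ P] exI[of _ 0]) auto
  then show "rational_character (\<lambda>(A, B). det B ^ 10)"
    by (auto simp: rational_character_def G_det det_mul power_mult_distrib)
  show "poly_at f (rho g X) = (case g of (A, B) \<Rightarrow> det B ^ 10) * poly_at f X" if "g \<in> G" "X \<in> V" for g X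
    using that by (cases g) (simp add: f rho_in_V det_Phi_rho G_det)
qed

text \<open>
  A relative invariant that vanishes at one point of the dense orbit vanishes on all of it and is zero. So the
  given one has no zeros there and is a power of \<open>f\<close>, and irreducibility leaves only the first power.
\<close>

lemma relative_invariant_unique:
  assumes f: "\<And>X. X \<in> V \<Longrightarrow> poly_at f X = det (Phi X)"
    and g: "irreducible g" "relative_invariant g \<psi>"
  shows "\<exists>c. c \<noteq> 0 \<and> g = const_mpoly c * f"
proof -
  let ?X = "sample 1 1"
  have inv: "poly_at g (rho h ?X) = \<psi> h * poly_at g ?X" "\<psi> h \<noteq> 0" if "h \<in> G" for h
    using g(2) that sample_in_V by (auto simp: relative_invariant_def rational_character_def)
  have "poly_at g ?X \<noteq> 0"
  proof
    assume "poly_at g ?X = 0"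
    then have "g = 0"
      using orbit_zariski_dense inv unfolding zariski_dense_def by simp
    then show False using g(1) by simp
  qed
  then have "poly_at g (rho h ?X) \<noteq> 0" if "h \<in> G" for h
    using inv[OF that] by simp
  then obtain c m where c: "c \<noteq> 0" "g = const_mpoly c * f ^ m"
    using nonvanishing_is_power[OF f] by metis
  have "m = 1"
  proof (rule ccontr)
    assume "m \<noteq> 1"
    then consider "m = 0" | n where "m = Suc (Suc n)"
      by (metis One_nat_def not0_implies_Suc)
    then show False
    proof cases
      case 1
      then show False using c const_mpoly_unit[of c] g(1) by (auto simp: irreducible_def)
    next
      case 2
      then have "g = (const_mpoly c * f) * (f * f ^ n)"
        by (simp add: c(2) mult.assoc)
      then have "const_mpoly c * f dvd 1 \<or> f * f ^ n dvd 1"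
        using g(1) irreducibleD by blast
      then show False
        using det_Phi_not_unit[OF f] dvd_mult_left dvd_mult_right by blast
    qed
  qed
  then show ?thesis using c by auto
qed

theorem theorem2p2:
  shows "Phi ` V = Sym4 \<and>
      prehomogeneous \<and>
      (\<exists>f :: coord mpoly.
         (\<forall>X\<in>V. poly_at f X = det (Phi X)) \<and>
         irreducible f \<and>
         homogeneous 40 f \<and>
         relative_invariant f (\<lambda>(A, B). det B ^ 10) \<and>
         (\<forall>g \<psi>. irreducible g \<and> relative_invariant g \<psi> \<longrightarrow>
            (\<exists>c. c \<noteq> 0 \<and> g = const_mpoly c * f)))"
proof -
  obtain f :: "coord mpoly" where "homogeneous 40 f" and f: "\<And>X. X \<in> V \<Longrightarrow> poly_at f X = det (Phi X)"
    using is_form_det_4[OF is_form_Phi] by (auto simp: is_form_def poly_at_def)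
  then show ?thesis
    using Phi_surjective prehomogeneous_V det_Phi_irreducible[OF f] det_Phi_relative_invariant[OF f]
      relative_invariant_unique[OF f] by blast
qed

end
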